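(* Let $\psi$ be a fast majorant, and let $\Omega_{3}$ be a bounded domain of $\mathbb{R}^{n}$, where $n\geq2$. If $u$ is a real-valued harmonic function in $\Omega_{3}$, then the following statements are equivalent. ($\mathscr{G}_{1}$) $u\in\mathscr{L}_{\psi,\mathrm{int}}(\Omega_{3})$; ($\mathscr{G}_{2}$) there is a positive constant $C$ such that $|\nabla u(x)|\leq C\,\dfrac{\psi(d_{\Omega_{3}}(x))}{d_{\Omega_{3}}(x)}$ for all $x\in\Omega_{3}$; ($\mathscr{G}_{3}$) $|u|\in\mathscr{L}_{\psi,\mathrm{int}}(\Omega_{3})$; ($\mathscr{G}_{4}$) for a given $p$, where $p\geq\frac{n-2}{n-1}$ if $n>2$ and $p>0$ if $n=2$, there is a positive constant $C$ such that $\tilde{I}_{u,p}(x)\leq C\,\dfrac{\psi(d_{\Omega_{3}}(x))}{d_{\Omega_{3}}(x)}$ for all $x\in\Omega_{3}$.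
   Context: Majorants: a continuous increasing function $\psi:[0,\infty)\to[0,\infty)$ with $\psi(0)=0$ is a majorant if $\psi(t)/t$ is non-increasing for $t>0$. A majorant $\psi$ is fast if there are $\delta_0>0$ and $C>0$ such that $\int_0^\delta\frac{\psi(t)}{t}dt\leq C\psi(\delta)$ for all $0<\delta<\delta_0$. Internal Lipschitz spaces: let $d_{\Omega_3}(x)$ be the Euclidean distance from $x$ to $\partial\Omega_3$. For $x_1,x_2\in\Omega_3$, $$d_{\psi,\Omega_3}(x_1,x_2)=\inf\int_\gamma\frac{\psi(d_{\Omega_3}(x))}{d_{\Omega_3}(x)}\,ds(x),$$ where $ds$ is arc length and the infimum is over all rectifiable curves $\gamma\subset\Omega_3$ joining $x_1$ to $x_2$. A function $F$ from $\Omega_3$ into $\mathbb{C}$ or $\mathbb{R}$ belongs to $\mathscr{L}_{\psi,\mathrm{int}}(\Omega_3)$ if there is a constant $C=C(F)>0$ such that $|F(x_1)-F(x_2)|\leq C\,d_{\psi,\Omega_3}(x_1,x_2)$ for all $x_1,x_2\in\Omega_3$. Means: with $\mathbf{B}^n(x,r)$ the open Euclidean ball in $\mathbb{R}^n$, $|\cdot|$ of a set its Lebesgue measure and $d\mu$ Lebesgue measure, $$\tilde{I}_{u,p}(x)=\left(\frac{1}{|\mathbf{B}^n(x,d_{\Omega_3}(x)/2)|}\int_{\mathbf{B}^n(x,d_{\Omega_3}(x)/2)}|\nabla u(y)|^p\,d\mu(y)\right)^{1/p}.$$ *)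

theory Defs
  imports "HOL-Analysis.Analysis"
begin

section \<open>Majorants\<close>

text \<open>
  A majorant is a function on \<open>[0,\<infinity>)\<close>; only its values there matter. \<open>Increasing\<close> is read
  in the weak sense.
\<close>

definition majorant :: "(real \<Rightarrow> real) \<Rightarrow> bool" where
  "majorant \<psi> \<longleftrightarrow>
     continuous_on {0..} \<psi> \<and> mono_on {0..} \<psi> \<and> (\<forall>t\<ge>0. 0 \<le> \<psi> t) \<and> \<psi> 0 = 0 \<and>
     antimono_on {0<..} (\<lambda>t. \<psi> t / t)"

text \<open>
  The integral is taken in the extended nonnegative reals, so that the bound includes its
  finiteness.
\<close>

definition fast_majorant :: "(real \<Rightarrow> real) \<Rightarrow> bool" where
  "fast_majorant \<psi> \<longleftrightarrow> majorant \<psi> \<and>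
     (\<exists>\<delta>\<^sub>0>0. \<exists>C>0. \<forall>\<delta>. 0 < \<delta> \<and> \<delta> < \<delta>\<^sub>0 \<longrightarrow>
        (\<integral>\<^sup>+t\<in>{0<..<\<delta>}. ennreal (\<psi> t / t) \<partial>lborel) \<le> ennreal (C * \<psi> \<delta>))"


section \<open>Arc length\<close>

definition polygonal_lengths :: "(real \<Rightarrow> 'a::metric_space) \<Rightarrow> real \<Rightarrow> real \<Rightarrow> real set" where
  "polygonal_lengths \<gamma> a b =
     {(\<Sum>i<n. dist (\<gamma> (t i)) (\<gamma> (t (Suc i)))) |(n::nat) (t::nat \<Rightarrow> real).
        mono_on {..n} t \<and> t 0 = a \<and> t n = b}"

definition rectifiable_path :: "(real \<Rightarrow> 'a::metric_space) \<Rightarrow> bool" where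
  "rectifiable_path \<gamma> \<longleftrightarrow> path \<gamma> \<and> bdd_above (polygonal_lengths \<gamma> 0 1)"

definition arc_length :: "(real \<Rightarrow> 'a::metric_space) \<Rightarrow> real \<Rightarrow> real \<Rightarrow> real" where
  "arc_length \<gamma> a b = Sup (polygonal_lengths \<gamma> a b)"

text \<open>
  The parametrization of a rectifiable path by arc length, defined on \<open>[0, L]\<close> with \<open>L\<close> the
  length of the path. The choice of \<open>t\<close> is immaterial: the arc length function is continuous,
  hence attains every value in \<open>[0, L]\<close>, and \<open>\<gamma>\<close> is constant wherever it is constant.
\<close>

definition arc_length_param :: "(real \<Rightarrow> 'a::metric_space) \<Rightarrow> real \<Rightarrow> 'a" where
  "arc_length_param \<gamma> s = \<gamma> (SOME t. t \<in> {0..1} \<and> arc_length \<gamma> 0 t = s)"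

definition arc_integral :: "(real \<Rightarrow> 'a::metric_space) \<Rightarrow> ('a \<Rightarrow> real) \<Rightarrow> real" where
  "arc_integral \<gamma> f = integral {0..arc_length \<gamma> 0 1} (\<lambda>s. f (arc_length_param \<gamma> s))"


section \<open>Internal Lipschitz spaces\<close>

definition int_dist :: "(real \<Rightarrow> real) \<Rightarrow> 'a::euclidean_space set \<Rightarrow> 'a \<Rightarrow> 'a \<Rightarrow> real" where
  "int_dist \<psi> \<Omega> x\<^sub>1 x\<^sub>2 =
     Inf {arc_integral \<gamma> (\<lambda>x. \<psi> (infdist x (frontier \<Omega>)) / infdist x (frontier \<Omega>)) |\<gamma>.
       rectifiable_path \<gamma> \<and> path_image \<gamma> \<subseteq> \<Omega> \<and> pathstart \<gamma> = x\<^sub>1 \<and> pathfinish \<gamma> = x\<^sub>2}"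

definition lipschitz_int ::
    "(real \<Rightarrow> real) \<Rightarrow> 'a::euclidean_space set \<Rightarrow> ('a \<Rightarrow> 'b::real_normed_vector) set" where
  "lipschitz_int \<psi> \<Omega> =
     {F. \<exists>C>0. \<forall>x\<^sub>1\<in>\<Omega>. \<forall>x\<^sub>2\<in>\<Omega>. norm (F x\<^sub>1 - F x\<^sub>2) \<le> C * int_dist \<psi> \<Omega> x\<^sub>1 x\<^sub>2}"


section \<open>Harmonic functions and means of the gradient\<close>

definition gradient :: "(real ^ 'n \<Rightarrow> real) \<Rightarrow> real ^ 'n \<Rightarrow> real ^ 'n" where
  "gradient u x = (\<chi> i. frechet_derivative u (at x) (axis i 1))"

definition laplacian :: "(real ^ 'n \<Rightarrow> real) \<Rightarrow> real ^ 'n \<Rightarrow> real" where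
  "laplacian u x = (\<Sum>i\<in>UNIV. frechet_derivative (gradient u) (at x) (axis i 1) $ i)"

text \<open>
  The first three conditions say that \<open>u\<close> is twice continuously differentiable on the open set
  \<open>\<Omega>\<close>; the values of \<open>u\<close> outside \<open>\<Omega>\<close> are irrelevant.
\<close>

definition harmonic_on :: "(real ^ 'n \<Rightarrow> real) \<Rightarrow> (real ^ 'n) set \<Rightarrow> bool" where
  "harmonic_on u \<Omega> \<longleftrightarrow>
     (\<forall>x\<in>\<Omega>. u differentiable (at x)) \<and>
     (\<forall>x\<in>\<Omega>. gradient u differentiable (at x)) \<and>
     (\<forall>i. continuous_on \<Omega> (\<lambda>x. frechet_derivative (gradient u) (at x) (axis i 1))) \<and>
     (\<forall>x\<in>\<Omega>. laplacian u x = 0)"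

definition grad_mean :: "(real ^ 'n) set \<Rightarrow> (real ^ 'n \<Rightarrow> real) \<Rightarrow> real \<Rightarrow> real ^ 'n \<Rightarrow> real" where
  "grad_mean \<Omega> u p x =
     (let B = ball x (infdist x (frontier \<Omega>) / 2)
      in (1 / measure lebesgue B * (LINT y:B|lebesgue. norm (gradient u y) powr p)) powr (1 / p))"

end

theory Submission
  imports Defs
begin

text \<open>
  Write \<open>d\<close> for the distance to the boundary and \<open>\<rho> = \<psi>(d)/d\<close> for the density of the
  internal metric. The four conditions are tied together by the pointwise gradient bound
  \<open>|\<nabla>u| \<le> C \<rho>\<close>.

  The internal metric is an infimum of integrals of \<open>\<rho>\<close> along curves. If the gradient is bounded
  by \<open>C \<rho>\<close>, integrating along a curve (\<open>abs_diff_le_arc_integral\<close>) bounds every difference of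
  values of \<open>u\<close> by \<open>C\<close> times the internal distance. Conversely, on the ball about \<open>x\<close> of radius
  \<open>d(x)/2\<close> the density is at most \<open>2 \<rho>(x)\<close>, because \<open>\<psi>\<close> increases and \<open>\<psi>(t)/t\<close> decreases
  (\<open>internal_density_le_twice\<close>). Hence a function that is Lipschitz for the internal metric is near
  \<open>x\<close> Lipschitz in the Euclidean sense with a constant comparable to \<open>\<rho>(x)\<close>, and this constant
  bounds the gradient. For this it suffices that \<open>|u|\<close> is Lipschitz: close to \<open>x\<close> either \<open>u\<close> keeps
  its sign or \<open>u(x) = 0\<close>, and in both cases \<open>||u(y)| - |u(x)|| = |u(y) - u(x)|\<close>
  (\<open>abs_diff_abs_eventually_eq\<close>).

  The comparability of \<open>\<rho>\<close> on half-balls also turns the pointwise bound into a bound on the means.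
  The converse is where harmonicity enters: \<open>|\<nabla>u(x)|\<close> is at most a constant times the \<open>p\<close>-mean
  of \<open>|\<nabla>u|\<close> over any ball about \<open>x\<close> in the domain (\<open>norm_gradient_le_power_mean\<close>). For \<open>p = 1\<close>
  this follows from the mean value property, which is obtained here for the weight
  \<open>max 0 (1 - |y|\<^sup>2)\<close>. The product of this weight with \<open>y\<close> is a multiple of the gradient of its
  square, so that one integration by parts shows that the weighted mean of \<open>u\<close> over a ball does not
  depend on the radius (\<open>harmonic_weighted_mean\<close>); differentiating in the centre gives the property
  for \<open>\<nabla>u\<close> (\<open>gradient_sub_mean\<close>).
  The passage from \<open>p = 1\<close> to an arbitrary \<open>p > 0\<close> uses only the resulting inequality on all
  smaller balls (\<open>power_mean_of_sub_mean\<close>).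
\<close>


section \<open>Parametrization by arc length\<close>

lemma polygonal_lengthsI:
  "mono_on {..n} t \<Longrightarrow> t 0 = a \<Longrightarrow> t n = b \<Longrightarrow>
    (\<Sum>i<n. dist (\<gamma> (t i)) (\<gamma> (t (Suc i)))) \<in> polygonal_lengths \<gamma> a b"
  unfolding polygonal_lengths_def by blast

lemma polygonal_lengthsE:
  assumes "l \<in> polygonal_lengths \<gamma> a b"
  obtains n t where "mono_on {..n} t" "t 0 = a" "t n = b"
    "l = (\<Sum>i<n. dist (\<gamma> (t i)) (\<gamma> (t (Suc i))))"
  using assms unfolding polygonal_lengths_def by blast

lemma mono_on_min_const: "mono_on S t \<Longrightarrow> mono_on S (\<lambda>i. min (t i) (b::real))"
  by (rule mono_onI, rule min.mono) (auto dest: mono_onD)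

lemma mono_on_max_const: "mono_on S t \<Longrightarrow> mono_on S (\<lambda>i. max (t i) (b::real))"
  by (rule mono_onI, rule max.mono) (auto dest: mono_onD)

lemma dist_mem_polygonal_lengths:
  assumes "a \<le> b"
  shows "dist (\<gamma> a) (\<gamma> b) \<in> polygonal_lengths \<gamma> a b"
  using polygonal_lengthsI[of 1 "\<lambda>i. if i = 0 then a else b" a b \<gamma>] assms
  by (auto simp: mono_on_def)

lemma polygonal_lengths_concat:
  assumes "l1 \<in> polygonal_lengths \<gamma> a b" "l2 \<in> polygonal_lengths \<gamma> b c"
  shows "l1 + l2 \<in> polygonal_lengths \<gamma> a c"
proof -
  obtain n1 t1 where 1: "mono_on {..n1} t1" "t1 0 = a" "t1 n1 = b"
      "l1 = (\<Sum>i<n1. dist (\<gamma> (t1 i)) (\<gamma> (t1 (Suc i))))"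
    using assms(1) by (rule polygonal_lengthsE)
  obtain n2 t2 where 2: "mono_on {..n2} t2" "t2 0 = b" "t2 n2 = c"
      "l2 = (\<Sum>i<n2. dist (\<gamma> (t2 i)) (\<gamma> (t2 (Suc i))))"
    using assms(2) by (rule polygonal_lengthsE)
  define t where "t i = (if i \<le> n1 then t1 i else t2 (i - n1))" for i
  have t2: "t (n1 + i) = t2 i" for i
    using 1(3) 2(2) by (auto simp: t_def)
  have split: "(\<Sum>i<m + n. f i) = (\<Sum>i<m. f i) + (\<Sum>i<n. f (m + i))" for f :: "nat \<Rightarrow> real" and m n
    by (induction n) auto
  have "mono_on {..n1 + n2} t"
  proof (rule mono_onI)
    fix i j assume ij: "i \<in> {..n1 + n2}" "j \<in> {..n1 + n2}" "i \<le> j"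
    show "t i \<le> t j"
    proof (cases "j \<le> n1")
      case True
      then show ?thesis using ij mono_onD[OF 1(1), of i j] by (auto simp: t_def)
    next
      case j: False
      show ?thesis
      proof (cases "i \<le> n1")
        case True
        then have "t i \<le> b" using mono_onD[OF 1(1), of i n1] 1(3) by (auto simp: t_def)
        also have "b \<le> t j"
          using j ij mono_onD[OF 2(1), of 0 "j - n1"] 2(2) by (auto simp: t_def)
        finally show ?thesis .
      next
        case False
        then show ?thesis
          using j ij mono_onD[OF 2(1), of "i - n1" "j - n1"] by (auto simp: t_def)
      qed
    qed
  qed
  moreover have "t 0 = a" "t (n1 + n2) = c"
    using 1(2) t2[of n2] 2(3) by (auto simp: t_def)
  moreover have "(\<Sum>i<n1 + n2. dist (\<gamma> (t i)) (\<gamma> (t (Suc i)))) = l1 + l2"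
    unfolding split 1(4) 2(4)
  proof (intro arg_cong2[where f="(+)"] sum.cong refl)
    show "dist (\<gamma> (t i)) (\<gamma> (t (Suc i))) = dist (\<gamma> (t1 i)) (\<gamma> (t1 (Suc i)))"
      if "i \<in> {..<n1}" for i
      using that by (simp add: t_def)
    show "dist (\<gamma> (t (n1 + i))) (\<gamma> (t (Suc (n1 + i)))) = dist (\<gamma> (t2 i)) (\<gamma> (t2 (Suc i)))" for i
      using t2[of i] t2[of "Suc i"] by simp
  qed
  ultimately show ?thesis
    using polygonal_lengthsI[of "n1 + n2" t a c \<gamma>] by simp
qed

context
  fixes \<gamma> :: "real \<Rightarrow> 'a::metric_space"
  assumes bdd: "bdd_above (polygonal_lengths \<gamma> 0 1)"
begin

lemma bdd_above_polygonal_lengths: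
  assumes "0 \<le> a" "a \<le> b" "b \<le> 1"
  shows "bdd_above (polygonal_lengths \<gamma> a b)"
proof -
  obtain M where M: "\<And>l. l \<in> polygonal_lengths \<gamma> 0 1 \<Longrightarrow> l \<le> M"
    using bdd by (auto simp: bdd_above_def)
  have "l \<le> M" if "l \<in> polygonal_lengths \<gamma> a b" for l
  proof -
    have "dist (\<gamma> 0) (\<gamma> a) + l + dist (\<gamma> b) (\<gamma> 1) \<in> polygonal_lengths \<gamma> 0 1"
      using that assms by (meson dist_mem_polygonal_lengths polygonal_lengths_concat)
    from M[OF this] show ?thesis
      using zero_le_dist[of "\<gamma> 0" "\<gamma> a"] zero_le_dist[of "\<gamma> b" "\<gamma> 1"] by linarith
  qed
  then show ?thesis by (auto simp: bdd_above_def)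
qed

lemma polygonal_length_le_arc_length:
  assumes "0 \<le> a" "a \<le> b" "b \<le> 1" "l \<in> polygonal_lengths \<gamma> a b"
  shows "l \<le> arc_length \<gamma> a b"
  unfolding arc_length_def by (rule cSup_upper[OF assms(4) bdd_above_polygonal_lengths[OF assms(1-3)]])

lemma dist_le_arc_length:
  assumes "0 \<le> a" "a \<le> b" "b \<le> 1"
  shows "dist (\<gamma> a) (\<gamma> b) \<le> arc_length \<gamma> a b"
  using polygonal_length_le_arc_length[OF assms dist_mem_polygonal_lengths] assms by simp

text \<open>
  Cutting every node of a partition of \<open>[a, c]\<close> off at \<open>b\<close>, by minimum and by maximum, yields
  partitions of \<open>[a, b]\<close> and \<open>[b, c]\<close>. By the triangle inequality on the one interval containing
  \<open>b\<close>, their lengths add up to at least the original one. The other inequality is concatenation.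
\<close>

lemma arc_length_split:
  assumes "0 \<le> a" "a \<le> b" "b \<le> c" "c \<le> 1"
  shows "arc_length \<gamma> a c = arc_length \<gamma> a b + arc_length \<gamma> b c"
proof (rule antisym)
  show "arc_length \<gamma> a c \<le> arc_length \<gamma> a b + arc_length \<gamma> b c"
    unfolding arc_length_def[of _ a c]
  proof (rule cSup_least)
    show "polygonal_lengths \<gamma> a c \<noteq> {}"
      using dist_mem_polygonal_lengths[of a c \<gamma>] assms by auto
  next
    fix l assume "l \<in> polygonal_lengths \<gamma> a c"
    then obtain n t where t: "mono_on {..n} t" "t 0 = a" "t n = c"
      "l = (\<Sum>i<n. dist (\<gamma> (t i)) (\<gamma> (t (Suc i))))"
      by (rule polygonal_lengthsE)
    have mono: "t i \<le> t (Suc i)" if "i < n" for i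
      using mono_onD[OF t(1), of i "Suc i"] that by auto
    have "l \<le> (\<Sum>i<n. dist (\<gamma> (min (t i) b)) (\<gamma> (min (t (Suc i)) b)) +
        dist (\<gamma> (max (t i) b)) (\<gamma> (max (t (Suc i)) b)))"
      unfolding t(4)
    proof (rule sum_mono)
      fix i assume "i \<in> {..<n}"
      then have "t i \<le> t (Suc i)" using mono by simp
      then consider "t (Suc i) \<le> b" | "b \<le> t i" | "t i \<le> b" "b \<le> t (Suc i)" by linarith
      then show "dist (\<gamma> (t i)) (\<gamma> (t (Suc i))) \<le> dist (\<gamma> (min (t i) b)) (\<gamma> (min (t (Suc i)) b)) +
        dist (\<gamma> (max (t i) b)) (\<gamma> (max (t (Suc i)) b))"
        using \<open>t i \<le> t (Suc i)\<close> by cases (auto simp: min_def max_def dist_triangle)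
    qed
    also have "\<dots> = (\<Sum>i<n. dist (\<gamma> (min (t i) b)) (\<gamma> (min (t (Suc i)) b))) +
        (\<Sum>i<n. dist (\<gamma> (max (t i) b)) (\<gamma> (max (t (Suc i)) b)))"
      by (rule sum.distrib)
    also have "\<dots> \<le> arc_length \<gamma> a b + arc_length \<gamma> b c"
    proof (intro add_mono polygonal_length_le_arc_length)
      show "(\<Sum>i<n. dist (\<gamma> (min (t i) b)) (\<gamma> (min (t (Suc i)) b))) \<in> polygonal_lengths \<gamma> a b"
        by (rule polygonal_lengthsI[where t="\<lambda>i. min (t i) b"])
           (use t assms in \<open>auto intro: mono_on_min_const\<close>)
      show "(\<Sum>i<n. dist (\<gamma> (max (t i) b)) (\<gamma> (max (t (Suc i)) b))) \<in> polygonal_lengths \<gamma> b c"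
        by (rule polygonal_lengthsI[where t="\<lambda>i. max (t i) b"])
           (use t assms in \<open>auto intro: mono_on_max_const\<close>)
    qed (use assms in auto)
    finally show "l \<le> arc_length \<gamma> a b + arc_length \<gamma> b c" .
  qed
  have ne: "polygonal_lengths \<gamma> a b \<noteq> {}" "polygonal_lengths \<gamma> b c \<noteq> {}"
    using dist_mem_polygonal_lengths assms by blast+
  have le: "l1 + l2 \<le> arc_length \<gamma> a c"
    if "l1 \<in> polygonal_lengths \<gamma> a b" "l2 \<in> polygonal_lengths \<gamma> b c" for l1 l2
    using polygonal_length_le_arc_length[OF _ _ _ polygonal_lengths_concat[OF that]] assms by simp
  have "l1 \<le> arc_length \<gamma> a c - arc_length \<gamma> b c" if "l1 \<in> polygonal_lengths \<gamma> a b" for l1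
  proof -
    have "arc_length \<gamma> b c \<le> arc_length \<gamma> a c - l1"
      unfolding arc_length_def[of _ b c]
      by (rule cSup_least[OF ne(2)]) (use le[OF that] in \<open>simp add: algebra_simps\<close>)
    then show ?thesis by simp
  qed
  then have "arc_length \<gamma> a b \<le> arc_length \<gamma> a c - arc_length \<gamma> b c"
    unfolding arc_length_def[of _ a b] by (rule cSup_least[OF ne(1)])
  then show "arc_length \<gamma> a b + arc_length \<gamma> b c \<le> arc_length \<gamma> a c" by simp
qed

lemma arc_length_nonneg: "0 \<le> a \<Longrightarrow> a \<le> b \<Longrightarrow> b \<le> 1 \<Longrightarrow> 0 \<le> arc_length \<gamma> a b"
  using dist_le_arc_length[of a b] zero_le_dist[of "\<gamma> a" "\<gamma> b"] by linarith

lemma arc_length_refl: "0 \<le> a \<Longrightarrow> a \<le> 1 \<Longrightarrow> arc_length \<gamma> a a = 0"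
  using arc_length_split[of a a a] by simp

lemma polygonal_length_near_arc_length:
  assumes "0 \<le> a" "a \<le> b" "b \<le> 1" "0 < \<epsilon>"
  obtains n t where "mono_on {..n} t" "t 0 = a" "t n = b"
    "arc_length \<gamma> a b - \<epsilon> < (\<Sum>i<n. dist (\<gamma> (t i)) (\<gamma> (t (Suc i))))"
proof -
  have "arc_length \<gamma> a b - \<epsilon> < Sup (polygonal_lengths \<gamma> a b)"
    using assms(4) by (simp add: arc_length_def)
  moreover have "polygonal_lengths \<gamma> a b \<noteq> {}"
    using dist_mem_polygonal_lengths assms by blast
  ultimately obtain l where "l \<in> polygonal_lengths \<gamma> a b" "arc_length \<gamma> a b - \<epsilon> < l"
    using less_cSup_iff[OF _ bdd_above_polygonal_lengths[OF assms(1-3)]] by blast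
  then show ?thesis using that unfolding polygonal_lengths_def by blast
qed

text \<open>
  Arc length is lower semicontinuous, as a supremum of the polygonal lengths, which vary
  continuously with the end point when the nodes are cut off there. The same holds for the length
  of the remaining part of the path, and the sum of the two is constant, so arc length is also
  upper semicontinuous.
\<close>

lemma continuous_on_arc_length:
  assumes \<gamma>: "continuous_on {0..1} \<gamma>"
  shows "continuous_on {0..1} (arc_length \<gamma> 0)"
  unfolding continuous_on_iff
proof (intro ballI allI impI)
  fix t \<epsilon> :: real assume t: "t \<in> {0..1}" and \<epsilon>: "0 < \<epsilon>"
  obtain n a where a: "mono_on {..n} a" "a 0 = 0" "a n = t"
    "arc_length \<gamma> 0 t - \<epsilon> < (\<Sum>i<n. dist (\<gamma> (a i)) (\<gamma> (a (Suc i))))"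
    using polygonal_length_near_arc_length[of 0 t \<epsilon>] t \<epsilon> by auto
  obtain m b where b: "mono_on {..m} b" "b 0 = t" "b m = 1"
    "arc_length \<gamma> t 1 - \<epsilon> < (\<Sum>i<m. dist (\<gamma> (b i)) (\<gamma> (b (Suc i))))"
    using polygonal_length_near_arc_length[of t 1 \<epsilon>] t \<epsilon> by auto
  have a_range: "a i \<in> {0..t}" if "i \<le> n" for i
    using mono_onD[OF a(1), of 0 i] mono_onD[OF a(1), of i n] a(2,3) that by auto
  have b_range: "b i \<in> {t..1}" if "i \<le> m" for i
    using mono_onD[OF b(1), of 0 i] mono_onD[OF b(1), of i m] b(2,3) that by auto
  define \<phi> where "\<phi> s = (\<Sum>i<n. dist (\<gamma> (min (a i) s)) (\<gamma> (min (a (Suc i)) s)))" for s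
  define \<theta> where "\<theta> s = (\<Sum>i<m. dist (\<gamma> (max (b i) s)) (\<gamma> (max (b (Suc i)) s)))" for s
  have \<gamma>_min: "continuous_on {0..1} (\<lambda>s. \<gamma> (min c s))"
    and \<gamma>_max: "continuous_on {0..1} (\<lambda>s. \<gamma> (max c s))" if "c \<in> {0..1}" for c
    using that by (auto intro!: continuous_intros continuous_on_compose2[OF \<gamma>])
  have "continuous_on {0..1} \<phi>" unfolding \<phi>_def
  proof (intro continuous_on_sum continuous_on_dist \<gamma>_min)
    show "a i \<in> {0..1}" "a (Suc i) \<in> {0..1}" if "i \<in> {..<n}" for i
      using a_range[of i] a_range[of "Suc i"] that t by auto
  qed
  moreover have "\<phi> t > arc_length \<gamma> 0 t - \<epsilon>"
    using a(4) a_range by (auto simp: \<phi>_def min_absorb1)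
  ultimately have "\<forall>\<^sub>F s in at t within {0..1}. arc_length \<gamma> 0 t - \<epsilon> < \<phi> s" "arc_length \<gamma> 0 t - \<epsilon> < \<phi> t"
    using t by (auto simp: continuous_on_def intro: order_tendstoD)
  then obtain d1 where d1: "d1 > 0"
    "\<And>s. s \<in> {0..1} \<Longrightarrow> dist s t < d1 \<Longrightarrow> arc_length \<gamma> 0 t - \<epsilon> < \<phi> s"
    unfolding eventually_at by metis
  have "continuous_on {0..1} \<theta>" unfolding \<theta>_def
  proof (intro continuous_on_sum continuous_on_dist \<gamma>_max)
    show "b i \<in> {0..1}" "b (Suc i) \<in> {0..1}" if "i \<in> {..<m}" for i
      using b_range[of i] b_range[of "Suc i"] that t by auto
  qed
  moreover have "\<theta> t > arc_length \<gamma> t 1 - \<epsilon>"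
    using b(4) b_range by (auto simp: \<theta>_def max_absorb1)
  ultimately have "\<forall>\<^sub>F s in at t within {0..1}. arc_length \<gamma> t 1 - \<epsilon> < \<theta> s" "arc_length \<gamma> t 1 - \<epsilon> < \<theta> t"
    using t by (auto simp: continuous_on_def intro: order_tendstoD)
  then obtain d2 where d2: "d2 > 0"
    "\<And>s. s \<in> {0..1} \<Longrightarrow> dist s t < d2 \<Longrightarrow> arc_length \<gamma> t 1 - \<epsilon> < \<theta> s"
    unfolding eventually_at by metis
  have "dist (arc_length \<gamma> 0 s) (arc_length \<gamma> 0 t) < \<epsilon>"
    if s: "s \<in> {0..1}" "dist s t < min d1 d2" for s
  proof (cases "s \<le> t")
    case True
    have "\<phi> s \<in> polygonal_lengths \<gamma> 0 s"
      unfolding \<phi>_def using a s True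
      by (intro polygonal_lengthsI[where t="\<lambda>i. min (a i) s"]) (auto intro: mono_on_min_const)
    then have "\<phi> s \<le> arc_length \<gamma> 0 s"
      using s by (intro polygonal_length_le_arc_length) auto
    moreover have "arc_length \<gamma> 0 t - \<epsilon> < \<phi> s" using d1(2) s by auto
    moreover have "arc_length \<gamma> 0 t = arc_length \<gamma> 0 s + arc_length \<gamma> s t" "0 \<le> arc_length \<gamma> s t"
      using arc_length_split[of 0 s t] arc_length_nonneg[of s t] s t True by auto
    ultimately show ?thesis by (simp add: dist_real_def)
  next
    case False
    have "\<theta> s \<in> polygonal_lengths \<gamma> s 1"
      unfolding \<theta>_def using b s False
      by (intro polygonal_lengthsI[where t="\<lambda>i. max (b i) s"]) (auto intro: mono_on_max_const)
    then have "\<theta> s \<le> arc_length \<gamma> s 1"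
      using s by (intro polygonal_length_le_arc_length) auto
    moreover have "arc_length \<gamma> t 1 - \<epsilon> < \<theta> s" using d2(2) s by auto
    moreover have "arc_length \<gamma> t 1 = arc_length \<gamma> t s + arc_length \<gamma> s 1" "0 \<le> arc_length \<gamma> t s"
      "arc_length \<gamma> 0 s = arc_length \<gamma> 0 t + arc_length \<gamma> t s"
      using arc_length_split[of t s 1] arc_length_nonneg[of t s] arc_length_split[of 0 t s] s t False by auto
    ultimately show ?thesis by (simp add: dist_real_def)
  qed
  then show "\<exists>d>0. \<forall>s\<in>{0..1}. dist s t < d \<longrightarrow> dist (arc_length \<gamma> 0 s) (arc_length \<gamma> 0 t) < \<epsilon>"
    using d1(1) d2(1) by (intro exI[of _ "min d1 d2"]) auto
qed

end

text \<open>
  The intermediate value theorem for arc length shows that the choice in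
  \<^const>\<open>arc_length_param\<close> is made from a nonempty set.
\<close>

lemma arc_length_param_eq:
  assumes \<gamma>: "rectifiable_path \<gamma>" and s: "s \<in> {0..arc_length \<gamma> 0 1}"
  obtains t where "t \<in> {0..1}" "arc_length \<gamma> 0 t = s" "arc_length_param \<gamma> s = \<gamma> t"
proof -
  have bdd: "bdd_above (polygonal_lengths \<gamma> 0 1)" and cont: "continuous_on {0..1} \<gamma>"
    using \<gamma> by (auto simp: rectifiable_path_def path_def)
  have "\<exists>t\<ge>0. t \<le> 1 \<and> arc_length \<gamma> 0 t = s"
    using s arc_length_refl[OF bdd, of 0]
    by (intro IVT' continuous_on_arc_length[OF bdd cont]) auto
  then have "\<exists>t. t \<in> {0..1} \<and> arc_length \<gamma> 0 t = s" by auto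
  from someI_ex[OF this] show ?thesis
    using that[of "SOME t. t \<in> {0..1} \<and> arc_length \<gamma> 0 t = s"] by (auto simp: arc_length_param_def)
qed

lemma arc_length_param_lipschitz:
  assumes \<gamma>: "rectifiable_path \<gamma>"
  shows "1-lipschitz_on {0..arc_length \<gamma> 0 1} (arc_length_param \<gamma>)"
proof (rule lipschitz_onI)
  have bdd: "bdd_above (polygonal_lengths \<gamma> 0 1)"
    using \<gamma> by (auto simp: rectifiable_path_def)
  have *: "dist (\<gamma> t) (\<gamma> t') \<le> \<bar>arc_length \<gamma> 0 t - arc_length \<gamma> 0 t'\<bar>"
    if "t \<in> {0..1}" "t' \<in> {0..1}" "t \<le> t'" for t t'
    using dist_le_arc_length[OF bdd, of t t'] arc_length_split[OF bdd, of 0 t t'] that by auto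
  fix s s' assume "s \<in> {0..arc_length \<gamma> 0 1}" "s' \<in> {0..arc_length \<gamma> 0 1}"
  then obtain t t' where "t \<in> {0..1}" "arc_length \<gamma> 0 t = s" "arc_length_param \<gamma> s = \<gamma> t"
    "t' \<in> {0..1}" "arc_length \<gamma> 0 t' = s'" "arc_length_param \<gamma> s' = \<gamma> t'"
    using arc_length_param_eq[OF \<gamma>] by metis
  then show "dist (arc_length_param \<gamma> s) (arc_length_param \<gamma> s') \<le> 1 * dist s s'"
    using *[of t t'] *[of t' t] by (cases "t \<le> t'") (auto simp: dist_real_def dist_commute abs_minus_commute)
qed auto

lemma arc_length_param_endpoints:
  assumes \<gamma>: "rectifiable_path \<gamma>"
  shows "arc_length_param \<gamma> 0 = pathstart \<gamma>"
    and "arc_length_param \<gamma> (arc_length \<gamma> 0 1) = pathfinish \<gamma>"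
    and "0 \<le> arc_length \<gamma> 0 1"
proof -
  have bdd: "bdd_above (polygonal_lengths \<gamma> 0 1)"
    using \<gamma> by (auto simp: rectifiable_path_def)
  show L: "0 \<le> arc_length \<gamma> 0 1" by (rule arc_length_nonneg[OF bdd]) auto
  obtain t where t: "t \<in> {0..1}" "arc_length \<gamma> 0 t = 0" "arc_length_param \<gamma> 0 = \<gamma> t"
    using arc_length_param_eq[OF \<gamma>, of 0] L by auto
  then show "arc_length_param \<gamma> 0 = pathstart \<gamma>"
    using dist_le_arc_length[OF bdd, of 0 t] by (auto simp: pathstart_def)
  obtain t' where t': "t' \<in> {0..1}" "arc_length \<gamma> 0 t' = arc_length \<gamma> 0 1"
    "arc_length_param \<gamma> (arc_length \<gamma> 0 1) = \<gamma> t'"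
    using arc_length_param_eq[OF \<gamma>, of "arc_length \<gamma> 0 1"] L by auto
  then show "arc_length_param \<gamma> (arc_length \<gamma> 0 1) = pathfinish \<gamma>"
    using dist_le_arc_length[OF bdd, of t' 1] arc_length_split[OF bdd, of 0 t' 1]
    by (auto simp: pathfinish_def)
qed

lemma lipschitz_path_rectifiable:
  assumes \<gamma>: "K-lipschitz_on {0..1} \<gamma>"
  shows "rectifiable_path \<gamma>" and "arc_length \<gamma> 0 1 \<le> K"
proof -
  have le: "l \<le> K" if l: "l \<in> polygonal_lengths \<gamma> 0 1" for l
  proof -
    obtain n t where t: "mono_on {..n} t" "t 0 = 0" "t n = 1"
      "l = (\<Sum>i<n. dist (\<gamma> (t i)) (\<gamma> (t (Suc i))))"
      using l by (rule polygonal_lengthsE)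
    have range: "t i \<in> {0..1}" if "i \<le> n" for i
      using mono_onD[OF t(1), of 0 i] mono_onD[OF t(1), of i n] t(2,3) that by auto
    have "l \<le> (\<Sum>i<n. K * (t (Suc i) - t i))"
      unfolding t(4)
    proof (rule sum_mono)
      fix i assume i: "i \<in> {..<n}"
      then have "dist (\<gamma> (t i)) (\<gamma> (t (Suc i))) \<le> K * dist (t i) (t (Suc i))"
        by (intro lipschitz_onD[OF \<gamma>] range) auto
      also have "dist (t i) (t (Suc i)) = t (Suc i) - t i"
        using mono_onD[OF t(1), of i "Suc i"] i by (auto simp: dist_real_def)
      finally show "dist (\<gamma> (t i)) (\<gamma> (t (Suc i))) \<le> K * (t (Suc i) - t i)" .
    qed
    also have "\<dots> = K" using t(2,3) by (simp flip: sum_distrib_left add: sum_lessThan_telescope)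
    finally show ?thesis .
  qed
  show "rectifiable_path \<gamma>"
    using le lipschitz_on_continuous_on[OF \<gamma>] by (auto simp: rectifiable_path_def path_def bdd_above_def)
  show "arc_length \<gamma> 0 1 \<le> K"
    unfolding arc_length_def
    by (rule cSup_least) (use le dist_mem_polygonal_lengths[of 0 1 \<gamma>] in auto)
qed

section \<open>Integrals along rectifiable curves\<close>

text \<open>
  The set where \<open>f\<close> is at most \<open>f a\<close> is compact, and a step forward from its largest element
  would lead to a larger one.
\<close>

lemma le_of_forward_steps:
  fixes f :: "real \<Rightarrow> real"
  assumes "a \<le> b" and f: "continuous_on {a..b} f"
    and step: "\<And>s. a \<le> s \<Longrightarrow> s < b \<Longrightarrow> \<exists>t>s. t \<le> b \<and> f t \<le> f s"
  shows "f b \<le> f a"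
proof -
  let ?S = "{a..b} \<inter> f -` {..f a}"
  have "compact ?S"
    using continuous_closed_preimage[OF f, of "{..f a}"] by (auto simp: compact_eq_bounded_closed bounded_Int)
  moreover have "?S \<noteq> {}" using \<open>a \<le> b\<close> by auto
  ultimately obtain s where s: "s \<in> ?S" "\<And>t. t \<in> ?S \<Longrightarrow> t \<le> s"
    using compact_attains_sup by metis
  have "\<not> s < b"
  proof
    assume "s < b"
    then obtain t where t: "t > s" "t \<le> b" "f t \<le> f s" using step[of s] s(1) by auto
    then have "t \<in> ?S" using s(1) by auto
    then show False using s(2) t(1) by fastforce
  qed
  then have "s = b" using s(1) by auto
  then show ?thesis using s(1) by auto
qed

text \<open>
  A rectifiable curve need not be differentiable, so the chain rule is not available. Instead, the
  differentiability of \<open>u\<close> at a single point of the curve and the bound \<open>1\<close> for the Lipschitz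
  constant of the arc length parametrization show that the inequality, with an error \<open>\<epsilon>\<close> per unit
  of length, survives a small step forward from each parameter.
\<close>

lemma abs_diff_le_arc_integral:
  fixes u g :: "'a::euclidean_space \<Rightarrow> real"
  assumes \<gamma>: "rectifiable_path \<gamma>" and sub: "path_image \<gamma> \<subseteq> \<Omega>"
    and u: "\<And>x. x \<in> \<Omega> \<Longrightarrow> (u has_derivative D x) (at x)"
    and D: "\<And>x h. x \<in> \<Omega> \<Longrightarrow> \<bar>D x h\<bar> \<le> g x * norm h"
    and g: "continuous_on \<Omega> g" "\<And>x. x \<in> \<Omega> \<Longrightarrow> 0 \<le> g x"
  shows "\<bar>u (pathfinish \<gamma>) - u (pathstart \<gamma>)\<bar> \<le> arc_integral \<gamma> g"
proof (rule field_le_epsilon)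
  fix \<epsilon>' :: real assume "0 < \<epsilon>'"
  define L where "L = arc_length \<gamma> 0 1"
  define \<eta> where "\<eta> = arc_length_param \<gamma>"
  have L: "0 \<le> L" and ends: "\<eta> 0 = pathstart \<gamma>" "\<eta> L = pathfinish \<gamma>"
    unfolding L_def \<eta>_def by (rule arc_length_param_endpoints[OF \<gamma>])+
  have lip: "1-lipschitz_on {0..L} \<eta>"
    unfolding L_def \<eta>_def by (rule arc_length_param_lipschitz[OF \<gamma>])
  have mem: "\<eta> s \<in> \<Omega>" if "s \<in> {0..L}" for s
    using arc_length_param_eq[OF \<gamma>, of s] that sub unfolding L_def \<eta>_def
    by (metis imageI path_image_def subsetD)
  \<comment> \<open>the summand \<open>1\<close> covers constant curves, which have length \<open>0\<close>\<close>
  define \<epsilon> where "\<epsilon> = \<epsilon>' / (L + 1)"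
  have \<epsilon>: "0 < \<epsilon>" "\<epsilon> * L \<le> \<epsilon>'"
    using \<open>0 < \<epsilon>'\<close> L by (auto simp: \<epsilon>_def divide_simps)
  define G where "G s = g (\<eta> s)" for s
  have contG: "continuous_on {0..L} G"
    unfolding G_def by (rule continuous_on_compose2[OF g(1) lipschitz_on_continuous_on[OF lip]]) (use mem in auto)
  have intG: "G integrable_on {a..b}" if "0 \<le> a" "b \<le> L" for a b
    by (rule integrable_continuous_real) (rule continuous_on_subset[OF contG], use that in auto)
  have contu: "continuous_on \<Omega> u"
    by (rule has_derivative_continuous_on[OF has_derivative_at_withinI[OF u]])
  define f where "f s = \<bar>u (\<eta> s) - u (\<eta> 0)\<bar> - integral {0..s} G - \<epsilon> * s" for s
  have "f L \<le> f 0"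
  proof (rule le_of_forward_steps[OF L])
    have "continuous_on {0..L} (\<lambda>s. u (\<eta> s))"
      by (rule continuous_on_compose2[OF contu lipschitz_on_continuous_on[OF lip]]) (use mem in auto)
    then show "continuous_on {0..L} f"
      unfolding f_def using intG[of 0 L]
      by (intro continuous_intros indefinite_integral_continuous_1) auto
    fix s assume s: "0 \<le> s" "s < L"
    then have sL: "s \<in> {0..L}" by simp
    obtain d where d: "0 < d" "\<And>y. norm (y - \<eta> s) < d \<Longrightarrow>
        norm (u y - u (\<eta> s) - D (\<eta> s) (y - \<eta> s)) \<le> \<epsilon> / 2 * norm (y - \<eta> s)"
      using u[OF mem[OF sL]] \<epsilon>(1) unfolding has_derivative_at_alt
      by (metis half_gt_zero)
    obtain d' where d': "0 < d'" "\<And>\<tau>. \<tau> \<in> {0..L} \<Longrightarrow> dist \<tau> s < d' \<Longrightarrow> dist (G \<tau>) (G s) < \<epsilon> / 2"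
      using contG sL \<epsilon>(1) unfolding continuous_on_iff by (metis half_gt_zero)
    define t where "t = s + min (min d d') (L - s) / 2"
    have t: "s < t" "t \<le> L" "t - s < d" "t - s < d'"
      using d(1) d'(1) s by (auto simp: t_def min_def field_simps)
    have \<eta>t: "norm (\<eta> t - \<eta> s) \<le> t - s"
      using lipschitz_onD[OF lip, of t s] s t by (auto simp: dist_norm)
    have "norm (\<eta> t - \<eta> s) < d" using \<eta>t t(3) by linarith
    then have "\<bar>u (\<eta> t) - u (\<eta> s)\<bar> \<le> \<bar>D (\<eta> s) (\<eta> t - \<eta> s)\<bar> + \<epsilon> / 2 * norm (\<eta> t - \<eta> s)"
      using d(2)[of "\<eta> t"] unfolding real_norm_def by linarith
    also have "\<dots> \<le> (G s + \<epsilon> / 2) * norm (\<eta> t - \<eta> s)"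
      using D[OF mem[OF sL], of "\<eta> t - \<eta> s"] by (simp add: G_def algebra_simps)
    also have "\<dots> \<le> (G s + \<epsilon> / 2) * (t - s)"
      using \<eta>t g(2)[OF mem[OF sL]] \<epsilon>(1) by (intro mult_left_mono) (auto simp: G_def)
    finally have 1: "\<bar>u (\<eta> t) - u (\<eta> s)\<bar> \<le> (G s + \<epsilon> / 2) * (t - s)" .
    have "integral {s..t} (\<lambda>_. G s - \<epsilon> / 2) \<le> integral {s..t} G"
    proof (rule integral_le)
      show "G s - \<epsilon> / 2 \<le> G \<tau>" if "\<tau> \<in> {s..t}" for \<tau>
      proof -
        have "dist (G \<tau>) (G s) < \<epsilon> / 2"
          by (rule d'(2)) (use that s t in \<open>auto simp: dist_real_def\<close>)
        then show ?thesis unfolding dist_real_def by linarith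
      qed
    qed (use intG s t in auto)
    then have 2: "(G s - \<epsilon> / 2) * (t - s) \<le> integral {s..t} G"
      using t(1) by (simp add: mult.commute)
    have 3: "integral {0..s} G + integral {s..t} G = integral {0..t} G"
      using s t by (intro Henstock_Kurzweil_Integration.integral_combine intG) auto
    have "\<bar>u (\<eta> t) - u (\<eta> s)\<bar> \<le> integral {s..t} G + (\<epsilon> * t - \<epsilon> * s)"
      using 1 2 by (simp add: algebra_simps diff_divide_distrib)
    then have "f t \<le> f s"
      using 3 unfolding f_def by linarith
    then show "\<exists>t>s. t \<le> L \<and> f t \<le> f s" using t by blast
  qed
  show "\<bar>u (pathfinish \<gamma>) - u (pathstart \<gamma>)\<bar> \<le> arc_integral \<gamma> g + \<epsilon>'"
  proof -
    have "arc_integral \<gamma> g = integral {0..L} G"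
      by (simp add: arc_integral_def G_def[abs_def] L_def \<eta>_def)
    then show ?thesis using \<open>f L \<le> f 0\<close> \<epsilon>(2) by (simp add: f_def ends)
  qed
qed

section \<open>Integration by parts for compactly supported functions\<close>

text \<open>
  Integrating functions of bounded support over the whole space makes the change of variables
  free of any bookkeeping of domains.
\<close>

lemma has_integral_affine_UNIV:
  fixes f :: "'a::euclidean_space \<Rightarrow> real"
  assumes f: "(f has_integral I) UNIV" and bdd: "bounded {x. f x \<noteq> 0}" and "m \<noteq> 0"
  shows "((\<lambda>y. f (m *\<^sub>R y + c)) has_integral I / \<bar>m\<bar> ^ DIM('a)) UNIV"
proof -
  obtain a b where ab: "{x. f x \<noteq> 0} \<subseteq> cbox a b"
    using bounded_subset_cbox_symmetric[OF bdd] by blast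
  have "(f has_integral I) (cbox a b)"
  proof -
    have "((\<lambda>x. if x \<in> cbox a b then f x else 0) has_integral I) UNIV"
      by (rule has_integral_eq[OF _ f]) (use ab in auto)
    then show ?thesis by (simp add: has_integral_restrict_UNIV)
  qed
  from has_integral_affinity[OF this \<open>m \<noteq> 0\<close>, of c] 
  have "((\<lambda>y. f (m *\<^sub>R y + c)) has_integral I / \<bar>m\<bar> ^ DIM('a))
      ((\<lambda>x. (1 / m) *\<^sub>R x + -((1 / m) *\<^sub>R c)) ` cbox a b)" by simp
  then show ?thesis
  proof (rule has_integral_on_superset)
    fix y assume y: "y \<notin> (\<lambda>x. (1 / m) *\<^sub>R x + -((1 / m) *\<^sub>R c)) ` cbox a b"
    have "y = (1 / m) *\<^sub>R (m *\<^sub>R y + c) + -((1 / m) *\<^sub>R c)"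
      using \<open>m \<noteq> 0\<close> by (simp add: algebra_simps)
    then have "m *\<^sub>R y + c \<notin> cbox a b" using y by blast
    then show "f (m *\<^sub>R y + c) = 0" using ab by blast
  qed auto
qed

lemma cball_subset_cbox_symmetric:
  "cball 0 r \<subseteq> cbox (- (r *\<^sub>R One)) (r *\<^sub>R (One::'a::euclidean_space))"
proof
  fix x :: 'a assume "x \<in> cball 0 r"
  then have "norm x \<le> r" by simp
  then have "\<bar>x \<bullet> i\<bar> \<le> r" if "i \<in> Basis" for i
    using Basis_le_norm[OF that, of x] by linarith
  then show "x \<in> cbox (- (r *\<^sub>R One)) (r *\<^sub>R (One::'a))"
    by (force simp: mem_box inner_diff_left abs_le_iff)
qed

lemma has_integral_compact_support:
  fixes f :: "'a::euclidean_space \<Rightarrow> real"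
  assumes "continuous_on UNIV f" and "\<And>y. r < norm y \<Longrightarrow> f y = 0"
  shows "(f has_integral integral (cbox (- (r *\<^sub>R One)) (r *\<^sub>R One)) f) UNIV"
proof (rule has_integral_on_superset)
  show "(f has_integral integral (cbox (- (r *\<^sub>R One)) (r *\<^sub>R One)) f) (cbox (- (r *\<^sub>R One)) (r *\<^sub>R One))"
    by (rule integrable_integral, rule integrable_continuous)
       (rule continuous_on_subset[OF assms(1)], auto)
  show "f x = 0" if "x \<notin> cbox (- (r *\<^sub>R One)) (r *\<^sub>R One)" for x
    using that cball_subset_cbox_symmetric[of r] assms(2)[of x] by (force simp: not_le[symmetric])
qed auto

lemmas integrable_compact_support = has_integral_integrable[OF has_integral_compact_support]
lemmas integral_compact_support = integral_unique[OF has_integral_compact_support]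

text \<open>
  A common support in a ball of radius \<open>r\<close> allows the parameter to be varied while the box of
  integration stays fixed.
\<close>

lemma leibniz_rule_compact_support:
  fixes f :: "real \<Rightarrow> 'a::euclidean_space \<Rightarrow> real"
  assumes fx: "\<And>s y. s \<in> U \<Longrightarrow> ((\<lambda>s. f s y) has_real_derivative fx s y) (at s within U)"
    and f: "\<And>s. s \<in> U \<Longrightarrow> continuous_on UNIV (f s)"
    and cont: "continuous_on (U \<times> UNIV) (\<lambda>(s, y). fx s y)"
    and supp: "\<And>s y. s \<in> U \<Longrightarrow> r < norm y \<Longrightarrow> f s y = 0"
      "\<And>s y. s \<in> U \<Longrightarrow> r < norm y \<Longrightarrow> fx s y = 0"
    and U: "s0 \<in> U" "convex U"
  shows "((\<lambda>s. integral UNIV (f s)) has_real_derivative integral UNIV (fx s0)) (at s0 within U)"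
proof -
  let ?K = "cbox (- (r *\<^sub>R One)) (r *\<^sub>R (One::'a))"
  have "((\<lambda>s. integral ?K (f s)) has_real_derivative integral ?K (fx s0)) (at s0 within U)"
  proof (rule leibniz_rule_field_derivative[OF fx _ _ U])
    show "f s integrable_on ?K" if "s \<in> U" for s
      by (rule integrable_continuous) (rule continuous_on_subset[OF f[OF that]], auto)
    show "continuous_on (U \<times> ?K) (\<lambda>(s, y). fx s y)"
      by (rule continuous_on_subset[OF cont]) auto
  qed auto
  moreover have "integral ?K (f s) = integral UNIV (f s)" if "s \<in> U" for s
    using integral_compact_support[OF f[OF that] supp(1)[OF that], of r] by simp
  moreover have "continuous_on UNIV (fx s0)"
  proof -
    have "continuous_on UNIV ((\<lambda>(s, y). fx s y) \<circ> Pair s0)"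
      by (rule continuous_on_compose) (auto intro!: continuous_intros continuous_on_subset[OF cont] U)
    then show ?thesis by (simp add: o_def)
  qed
  then have "integral ?K (fx s0) = integral UNIV (fx s0)"
    using integral_compact_support[of "fx s0" r] supp(2) U by simp
  ultimately show ?thesis
    using has_field_derivative_transform_within[of "\<lambda>s. integral ?K (f s)" _ s0 U 1] U(1) by simp
qed

text \<open>
  This is integration by parts without a boundary term. Translation along \<open>e\<close> does not change the
  integral of \<open>G\<close>, so its derivative with respect to the translation parameter vanishes.
\<close>

lemma integral_directional_derivative_eq_0:
  fixes G :: "'a::euclidean_space \<Rightarrow> real"
  assumes der: "\<And>y. ((\<lambda>t. G (y + t *\<^sub>R e)) has_real_derivative G' y) (at 0)"
    and G: "continuous_on UNIV G" and G': "continuous_on UNIV G'"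
    and supp: "\<And>y. r < norm y \<Longrightarrow> G y = 0"
  shows "integral UNIV G' = 0"
proof -
  let ?U = "{-1<..<1::real}"
  have supp': "G' y = 0" if "r < norm y" for y
  proof -
    have "eventually (\<lambda>t. y + t *\<^sub>R e \<in> - cball 0 r) (at (0::real))"
    proof (rule topological_tendstoD)
      have "((\<lambda>t. y + t *\<^sub>R e) \<longlongrightarrow> y + 0 *\<^sub>R e) (at 0)"
        by (intro tendsto_intros)
      then show "((\<lambda>t. y + t *\<^sub>R e) \<longlongrightarrow> y) (at 0)" by simp
    qed (use that in auto)
    then have "eventually (\<lambda>t. G (y + t *\<^sub>R e) = 0) (at (0::real))"
      by eventually_elim (auto intro: supp)
    then have "eventually (\<lambda>t. G (y + t *\<^sub>R e) = 0) (nhds (0::real))"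
      using supp[OF that] by (auto simp: eventually_at_filter elim!: eventually_mono)
    then have "((\<lambda>t. G (y + t *\<^sub>R e)) has_real_derivative 0) (at 0)"
      by (subst DERIV_cong_ev[OF refl _ refl, where g="\<lambda>_. 0"]) auto
    then show ?thesis using der DERIV_unique by blast
  qed
  have far: "r < norm (y + t *\<^sub>R e)" if "t \<in> ?U" "r + norm e < norm y" for y t
  proof -
    have "\<bar>t\<bar> * norm e \<le> norm e" using that by (intro mult_left_le_one_le) auto
    moreover have "norm y - norm (t *\<^sub>R e) \<le> norm (y + t *\<^sub>R e)" by (rule norm_diff_ineq)
    ultimately show ?thesis using that(2) by simp
  qed
  have "((\<lambda>t. integral UNIV (\<lambda>y. G (y + t *\<^sub>R e))) has_real_derivative
      integral UNIV (\<lambda>y. G' (y + 0 *\<^sub>R e))) (at 0 within ?U)"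
  proof (rule leibniz_rule_compact_support[where r="r + norm e"])
    show "((\<lambda>s. G (y + s *\<^sub>R e)) has_real_derivative G' (y + s *\<^sub>R e)) (at s within ?U)" for s y
    proof -
      have "(\<lambda>t. G (y + (t + s) *\<^sub>R e)) = (\<lambda>t. G ((y + s *\<^sub>R e) + t *\<^sub>R e))"
        by (intro ext arg_cong[where f=G]) (simp add: algebra_simps)
      then show ?thesis
        using der[of "y + s *\<^sub>R e"] DERIV_shift[of "\<lambda>s. G (y + s *\<^sub>R e)" _ 0 s]
        by (simp add: has_field_derivative_at_within)
    qed
    show "continuous_on UNIV (\<lambda>y. G (y + s *\<^sub>R e))" for s
      by (auto intro!: continuous_intros continuous_on_compose2[OF G])
    show "continuous_on (?U \<times> UNIV) (\<lambda>(s, y). G' (y + s *\<^sub>R e))"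
      by (auto simp: case_prod_unfold intro!: continuous_intros continuous_on_compose2[OF G'])
  qed (use far supp supp' in auto)
  then have "((\<lambda>t. integral UNIV (\<lambda>y. G (y + t *\<^sub>R e))) has_real_derivative
      integral UNIV G') (at 0)"
    by (simp add: at_within_open[of 0 ?U])
  moreover have "integral UNIV (\<lambda>y. G (y + t *\<^sub>R e)) = integral UNIV G" for t
  proof -
    have "bounded {x. G x \<noteq> 0}"
      by (rule bounded_subset[OF bounded_cball[of 0 r]]) (use supp in \<open>auto simp: not_less[symmetric]\<close>)
    then have "((\<lambda>y. G (1 *\<^sub>R y + t *\<^sub>R e)) has_integral integral UNIV G / \<bar>1\<bar> ^ DIM('a)) UNIV"
      using supp by (intro has_integral_affine_UNIV integrable_integral integrable_compact_support[OF G, of r]) auto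
    then show ?thesis by (simp add: integral_unique)
  qed
  ultimately have "((\<lambda>t. integral UNIV G) has_real_derivative integral UNIV G') (at (0::real))"
    by simp
  then show ?thesis using DERIV_unique DERIV_const by blast
qed

text \<open>
  The function \<open>F\<close> is typically known, or continuous, only where the argument stays in the domain
  of the harmonic function; the cutoff \<open>\<eta>\<close> vanishes elsewhere, so whatever values \<open>F\<close> takes there
  do no harm.
\<close>

lemma continuous_on_mult_cutoff:
  fixes F \<eta> :: "'a::topological_space \<Rightarrow> real" and g :: "'a \<Rightarrow> real"
  assumes g: "continuous_on Z g" and F: "continuous_on {z \<in> Z. g z \<le> c} F"
    and \<eta>: "continuous_on Z \<eta>" and 0: "\<And>z. z \<in> Z \<Longrightarrow> c \<le> g z \<Longrightarrow> \<eta> z = 0"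
  shows "continuous_on Z (\<lambda>z. F z * \<eta> z)"
proof -
  have Z: "Z = {z \<in> Z. g z \<le> c} \<union> {z \<in> Z. c \<le> g z}" by auto
  have *: "{z \<in> Z. g z \<le> c} = Z \<inter> g -` {..c}" "{z \<in> Z. c \<le> g z} = Z \<inter> g -` {c..}" by auto
  have "continuous_on ({z \<in> Z. g z \<le> c} \<union> {z \<in> Z. c \<le> g z}) (\<lambda>z. F z * \<eta> z)"
  proof (rule continuous_on_Un_local)
    show "closedin (top_of_set ({z \<in> Z. g z \<le> c} \<union> {z \<in> Z. c \<le> g z})) {z \<in> Z. g z \<le> c}"
      unfolding Z[symmetric] unfolding * by (intro continuous_closedin_preimage g) auto
    show "closedin (top_of_set ({z \<in> Z. g z \<le> c} \<union> {z \<in> Z. c \<le> g z})) {z \<in> Z. c \<le> g z}"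
      unfolding Z[symmetric] unfolding * by (intro continuous_closedin_preimage g) auto
    show "continuous_on {z \<in> Z. g z \<le> c} (\<lambda>z. F z * \<eta> z)"
      by (intro continuous_on_mult F continuous_on_subset[OF \<eta>]) auto
    show "continuous_on {z \<in> Z. c \<le> g z} (\<lambda>z. F z * \<eta> z)"
      by (subst continuous_on_cong[OF refl, where g="\<lambda>_. 0"]) (use 0 in auto)
  qed
  then show ?thesis using Z by simp
qed

section \<open>The weighted mean value property\<close>

lemma harmonic_on_derivatives:
  fixes u :: "real ^ 'n \<Rightarrow> real"
  assumes "harmonic_on u \<Omega>"
  shows harmonic_on_has_derivative:
      "x \<in> \<Omega> \<Longrightarrow> (u has_derivative (\<lambda>h. gradient u x \<bullet> h)) (at x)"
    and harmonic_on_gradient_has_derivative: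
      "x \<in> \<Omega> \<Longrightarrow> (gradient u has_derivative frechet_derivative (gradient u) (at x)) (at x)"
    and harmonic_on_continuous_gradient: "continuous_on \<Omega> (gradient u)"
    and harmonic_on_continuous: "continuous_on \<Omega> u"
proof -
  have u: "u differentiable (at x)" and grad: "gradient u differentiable (at x)" if "x \<in> \<Omega>" for x
    using assms that by (auto simp: harmonic_on_def)
  show "(gradient u has_derivative frechet_derivative (gradient u) (at x)) (at x)" if "x \<in> \<Omega>"
    using grad[OF that] by (simp add: frechet_derivative_works)
  show "continuous_on \<Omega> (gradient u)" "continuous_on \<Omega> u"
    by (auto intro!: continuous_at_imp_continuous_on differentiable_imp_continuous_within u grad)
  show "(u has_derivative (\<lambda>h. gradient u x \<bullet> h)) (at x)" if "x \<in> \<Omega>"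
  proof -
    have D: "(u has_derivative frechet_derivative u (at x)) (at x)"
      using u[OF that] by (simp add: frechet_derivative_works)
    interpret linear "frechet_derivative u (at x)"
      using D by (rule has_derivative_linear)
    have "frechet_derivative u (at x) h = gradient u x \<bullet> h" for h
    proof -
      have "frechet_derivative u (at x) h = frechet_derivative u (at x) (\<Sum>i\<in>UNIV. (h $ i) *\<^sub>R axis i 1)"
        by (simp add: basis_expansion scalar_mult_eq_scaleR[symmetric])
      also have "\<dots> = gradient u x \<bullet> h"
        by (simp add: sum scale inner_vec_def gradient_def mult.commute)
      finally show ?thesis .
    qed
    then have "frechet_derivative u (at x) = (\<lambda>h. gradient u x \<bullet> h)" by blast
    then show ?thesis using D by simp
  qed
qed

text \<open>
  The cap of a paraboloid over the unit ball. It is Lipschitz and vanishes outside the ball, and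
  its square is continuously differentiable with gradient \<open>-4 cap(y) y\<close>.
\<close>

definition cap :: "'a::real_inner \<Rightarrow> real" where
  "cap y = max 0 (1 - y \<bullet> y)"

lemma cap_nonneg: "0 \<le> cap y" and cap_le_1: "cap y \<le> 1"
  by (auto simp: cap_def)

lemma cap_eq_0: "1 \<le> norm y \<Longrightarrow> cap y = 0"
  by (simp add: cap_def norm_eq_sqrt_inner)

lemma continuous_on_cap [continuous_intros]:
  "continuous_on S f \<Longrightarrow> continuous_on S (\<lambda>x. cap (f x))"
  unfolding cap_def by (intro continuous_intros)

lemma integral_cap_pos: "0 < integral UNIV (cap :: 'a::euclidean_space \<Rightarrow> real)"
proof -
  let ?K = "cbox (- (1 *\<^sub>R One)) (1 *\<^sub>R (One::'a))"
  have cont: "continuous_on S (cap :: 'a \<Rightarrow> real)" for S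
    by (rule continuous_on_cap[OF continuous_on_id, unfolded id_def]) 
  have I: "integral UNIV (cap :: 'a \<Rightarrow> real) = integral ?K cap"
    by (rule integral_compact_support[OF cont]) (simp add: cap_eq_0)
  have "integral ?K (cap :: 'a \<Rightarrow> real) \<noteq> 0"
  proof
    assume "integral ?K (cap :: 'a \<Rightarrow> real) = 0"
    then have "(cap has_integral 0) ?K"
      using integrable_integral[OF integrable_continuous[OF cont]] by metis
    then have "cap (0::'a) = 0"
      by (rule has_integral_0_cbox_imp_0[OF cont cap_nonneg]) (auto simp: mem_box box_eq_empty)
    then show False by (simp add: cap_def)
  qed
  moreover have "0 \<le> integral ?K (cap :: 'a \<Rightarrow> real)"
    by (rule integral_nonneg[OF integrable_continuous[OF cont]]) (rule cap_nonneg)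
  ultimately show ?thesis using I by linarith
qed

lemma DERIV_positive_part_square:
  "((\<lambda>v. (max 0 v)\<^sup>2) has_real_derivative 2 * max 0 v) (at v)"
proof -
  consider "v > 0" | "v < 0" | "v = 0" by linarith
  then show ?thesis
  proof cases
    case 1
    have "((\<lambda>v. v\<^sup>2) has_real_derivative 2 * max 0 v) (at v)"
      using 1 by (auto intro!: derivative_eq_intros)
    then show ?thesis
      by (rule has_field_derivative_transform_within_open[where S="{0<..}"]) (use 1 in auto)
  next
    case 2
    have "((\<lambda>v. 0) has_real_derivative 2 * max 0 v) (at v)"
      using 2 by auto
    then show ?thesis
      by (rule has_field_derivative_transform_within_open[where S="{..<0}"]) (use 2 in auto)
  next
    case 3
    have "((\<lambda>h. ((max 0 h)\<^sup>2) / h) \<longlongrightarrow> 0) (at (0::real))"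
    proof (rule Lim_null_comparison)
      show "\<forall>\<^sub>F h in at 0. norm ((max 0 h)\<^sup>2 / h) \<le> \<bar>h\<bar>"
        by (rule eventuallyI) (auto simp: max_def power2_eq_square)
      show "((\<lambda>h. \<bar>h\<bar>) \<longlongrightarrow> 0) (at (0::real))"
        by (rule tendsto_rabs_zero) simp
    qed
    then show ?thesis using 3 by (simp add: DERIV_def)
  qed
qed

text \<open>
  The derivative in \<open>s\<close> of the weighted mean over the ball of radius \<open>s\<close> is the integral of
  \<open>\<nabla>u(x + s y) \<cdot> y cap(y)\<close>. Since \<open>-4 cap(y) y\<close> is the gradient of \<open>cap\<^sup>2\<close>, integration by
  parts turns it into a multiple of the integral of \<open>\<Delta>u(x + s y) cap(y)\<^sup>2\<close>, which is zero. So
  the weighted mean equals its value for \<open>s = 0\<close>.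
\<close>

lemma harmonic_weighted_mean:
  fixes u :: "real ^ 'n \<Rightarrow> real"
  assumes u: "harmonic_on u \<Omega>" and sub: "cball x R \<subseteq> \<Omega>" and R: "0 \<le> R"
  shows "integral UNIV (\<lambda>y. u (x + R *\<^sub>R y) * cap y) = u x * integral UNIV (cap :: real ^ 'n \<Rightarrow> real)"
proof -
  let ?S = "{0..R}"
  define D where "D z i = frechet_derivative (gradient u) (at z) (axis i 1)" for z and i :: 'n
  have mem: "x + s *\<^sub>R y \<in> \<Omega>" if "s \<in> ?S" "norm y \<le> 1" for s y
  proof -
    have "s * norm y \<le> R" using that mult_mono[of s R "norm y" 1] by auto
    then show ?thesis using that by (intro subsetD[OF sub]) (auto simp: dist_norm)
  qed
  have contD: "continuous_on \<Omega> (\<lambda>z. D z i)" and lap: "z \<in> \<Omega> \<Longrightarrow> (\<Sum>i\<in>UNIV. D z i $ i) = 0" for i z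
    using u by (auto simp: harmonic_on_def laplacian_def D_def)
  note contu = harmonic_on_continuous[OF u] and contg = harmonic_on_continuous_gradient[OF u]
  define fx where "fx s y = (gradient u (x + s *\<^sub>R y) \<bullet> y) * cap y" for s and y :: "real ^ 'n"
  have contfx: "continuous_on (?S \<times> UNIV) (\<lambda>(s, y). fx s y)"
    unfolding fx_def case_prod_unfold
    by (rule continuous_on_mult_cutoff[where g="\<lambda>z. norm (snd z)" and c=1])
       (auto intro!: continuous_intros continuous_on_compose2[OF contg] mem simp: cap_eq_0)
  have contfx1: "continuous_on UNIV (fx s)" if "s \<in> ?S" for s
    unfolding fx_def by (rule continuous_on_mult_cutoff[where g="norm" and c=1])
       (use that in \<open>auto intro!: continuous_intros continuous_on_compose2[OF contg] mem simp: cap_eq_0\<close>)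
  have der0: "integral UNIV (fx s) = 0" if s: "s \<in> ?S" for s
  proof -
    \<comment> \<open>the partial derivative in the \<open>i\<close>-th direction of the \<open>i\<close>-th component of \<open>cap\<^sup>2\<close> times
      the gradient of \<open>u\<close>\<close>
    define G' where "G' i y = s * (D (x + s *\<^sub>R y) i $ i) * (cap y)\<^sup>2
      + (gradient u (x + s *\<^sub>R y) $ i) * (- 4 * cap y * y $ i)" for i and y :: "real ^ 'n"
    have contG': "continuous_on UNIV (G' i)" for i
    proof -
      have "continuous_on UNIV (\<lambda>y. (s * (D (x + s *\<^sub>R y) i $ i) * cap y) * cap y)"
        by (rule continuous_on_mult_cutoff[where g="norm" and c=1])
           (use s in \<open>auto intro!: continuous_intros continuous_on_compose2[OF contD] mem simp: cap_eq_0\<close>)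
      moreover have "continuous_on UNIV (\<lambda>y. (- 4 * (gradient u (x + s *\<^sub>R y) $ i) * y $ i) * cap y)"
        by (rule continuous_on_mult_cutoff[where g="norm" and c=1])
           (use s in \<open>auto intro!: continuous_intros continuous_on_compose2[OF contg] mem simp: cap_eq_0\<close>)
      ultimately have "continuous_on UNIV (\<lambda>y. (s * (D (x + s *\<^sub>R y) i $ i) * cap y) * cap y
          + (- 4 * (gradient u (x + s *\<^sub>R y) $ i) * y $ i) * cap y)"
        by (rule continuous_on_add)
      then show ?thesis unfolding G'_def by (simp add: power2_eq_square mult_ac)
    qed
    have "integral UNIV (G' i) = 0" for i
    proof (rule integral_directional_derivative_eq_0)
      let ?G = "\<lambda>y. (gradient u (x + s *\<^sub>R y) $ i) * (cap y)\<^sup>2"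
      show "((\<lambda>t. ?G (y + t *\<^sub>R axis i 1)) has_real_derivative G' i y) (at 0)" for y
      proof (cases "norm y \<le> 1")
        case True
        have 1: "((\<lambda>t. gradient u (x + s *\<^sub>R (y + t *\<^sub>R axis i 1)) $ i) has_real_derivative
            s * (D (x + s *\<^sub>R y) i $ i)) (at 0)"
        proof -
          let ?D = "frechet_derivative (gradient u) (at (x + s *\<^sub>R y))"
          have D: "(gradient u has_derivative ?D) (at (x + s *\<^sub>R (y + 0 *\<^sub>R axis i 1)))"
            using harmonic_on_gradient_has_derivative[OF u mem[OF s True]] by simp
          have "((\<lambda>t. x + s *\<^sub>R (y + t *\<^sub>R axis i 1)) has_derivative (\<lambda>t. s *\<^sub>R (t *\<^sub>R axis i 1))) (at 0)"
            by (auto intro!: derivative_eq_intros)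
          from has_derivative_compose[OF this D]
          have "((\<lambda>t. gradient u (x + s *\<^sub>R (y + t *\<^sub>R axis i 1)) $ i) has_derivative
              (\<lambda>t. ?D (s *\<^sub>R (t *\<^sub>R axis i 1)) $ i)) (at 0)"
            by (rule bounded_linear.has_derivative[OF bounded_linear_vec_nth])
          moreover have "?D (s *\<^sub>R (t *\<^sub>R axis i 1)) $ i = s * (D (x + s *\<^sub>R y) i $ i) * t" for t
            using linear_scale[OF has_derivative_linear[OF D]] by (simp add: D_def)
          ultimately show ?thesis by (simp add: has_field_derivative_def)
        qed
        have 2: "((\<lambda>t. (cap (y + t *\<^sub>R axis i 1))\<^sup>2) has_real_derivative - 4 * cap y * y $ i) (at 0)"
        proof -
          have "((\<lambda>t. 1 - (y + t *\<^sub>R axis i 1) \<bullet> (y + t *\<^sub>R axis i 1)) has_real_derivative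
              - (2 * y $ i)) (at 0)"
            by (auto intro!: derivative_eq_intros
                simp: inner_add_left inner_add_right inner_axis inner_axis' has_field_derivative_def)
          from DERIV_chain2[OF DERIV_positive_part_square this]
          show ?thesis by (simp add: cap_def mult_ac)
        qed
        show ?thesis
          using DERIV_mult[OF 1 2] by (simp add: G'_def algebra_simps)
      next
        case False
        have "((\<lambda>t. y + t *\<^sub>R axis i 1) \<longlongrightarrow> y + 0 *\<^sub>R axis i 1) (at (0::real))"
          by (intro tendsto_intros)
        then have "\<forall>\<^sub>F t in at (0::real). y + t *\<^sub>R axis i 1 \<in> - cball 0 1"
          by (rule topological_tendstoD) (use False in auto)
        then have "\<forall>\<^sub>F t in nhds (0::real). y + t *\<^sub>R axis i 1 \<in> - cball 0 1"
          using False by (auto simp: eventually_at_filter elim!: eventually_mono)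
        then have "\<forall>\<^sub>F t in nhds (0::real). ?G (y + t *\<^sub>R axis i 1) = 0"
          by eventually_elim (simp add: cap_eq_0)
        moreover have "G' i y = 0" using False by (simp add: G'_def cap_eq_0)
        ultimately show ?thesis
          by (subst DERIV_cong_ev[OF refl _ refl, where g="\<lambda>_. 0"]) auto
      qed
      have "continuous_on UNIV (\<lambda>y. ((gradient u (x + s *\<^sub>R y) $ i) * cap y) * cap y)"
        by (rule continuous_on_mult_cutoff[where g="norm" and c=1])
           (use s in \<open>auto intro!: continuous_intros continuous_on_compose2[OF contg] mem simp: cap_eq_0\<close>)
      then show "continuous_on UNIV ?G" by (simp add: power2_eq_square mult_ac)
      show "?G y = 0" if "1 < norm y" for y using that by (simp add: cap_eq_0)
    qed (rule contG')
    then have "0 = (\<Sum>i\<in>UNIV. integral UNIV (G' i))" by simp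
    also have "\<dots> = integral UNIV (\<lambda>y. \<Sum>i\<in>UNIV. G' i y)"
      by (intro integral_sum[symmetric] integrable_compact_support[OF contG', of 1])
         (auto simp: G'_def cap_eq_0)
    also have "(\<lambda>y. \<Sum>i\<in>UNIV. G' i y) = (\<lambda>y. - 4 * fx s y)"
    proof
      fix y :: "real ^ 'n"
      have "(\<Sum>i\<in>UNIV. G' i y) = s * (\<Sum>i\<in>UNIV. D (x + s *\<^sub>R y) i $ i) * (cap y)\<^sup>2 - 4 * fx s y"
        unfolding G'_def fx_def sum.distrib inner_vec_def 
        by (simp add: sum_distrib_left sum_distrib_right sum_negf mult_ac)
      also have "s * (\<Sum>i\<in>UNIV. D (x + s *\<^sub>R y) i $ i) * (cap y)\<^sup>2 = 0"
        using lap[OF mem[OF s, of y]] cap_eq_0[of y] by (cases "norm y \<le> 1") auto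
      finally show "(\<Sum>i\<in>UNIV. G' i y) = - 4 * fx s y" by simp
    qed
    finally show ?thesis by simp
  qed
  have "((\<lambda>s. integral UNIV (\<lambda>y. u (x + s *\<^sub>R y) * cap y)) has_real_derivative integral UNIV (fx s)) (at s within ?S)"
    if s: "s \<in> ?S" for s
  proof (rule leibniz_rule_compact_support[where r=1])
    show "((\<lambda>s. u (x + s *\<^sub>R y) * cap y) has_real_derivative fx s y) (at s within ?S)"
      if "s \<in> ?S" for s y
    proof (cases "norm y \<le> 1")
      case True
      have "((\<lambda>s. x + s *\<^sub>R y) has_derivative (\<lambda>h. h *\<^sub>R y)) (at s)"
        by (auto intro!: derivative_eq_intros)
      from has_derivative_compose[OF this harmonic_on_has_derivative[OF u mem[OF that True]]]
      have "((\<lambda>s. u (x + s *\<^sub>R y)) has_real_derivative gradient u (x + s *\<^sub>R y) \<bullet> y) (at s)"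
        by (simp add: has_field_derivative_def mult_commute_abs)
      then show ?thesis
        unfolding fx_def by (rule DERIV_cmult_right[THEN has_field_derivative_at_within])
    qed (simp add: fx_def cap_eq_0)
    show "continuous_on UNIV (\<lambda>y. u (x + s *\<^sub>R y) * cap y)" if "s \<in> ?S" for s
    proof (rule continuous_on_mult_cutoff[where g="norm" and c=1])
      show "continuous_on {y \<in> UNIV. norm y \<le> 1} (\<lambda>y. u (x + s *\<^sub>R y))"
        by (rule continuous_on_compose2[OF contu]) (use mem that in \<open>auto intro!: continuous_intros\<close>)
    qed (auto intro!: continuous_intros simp: cap_eq_0)
    show "continuous_on (?S \<times> UNIV) (\<lambda>(s, y). fx s y)" by (rule contfx)
  qed (use s in \<open>auto simp: fx_def cap_eq_0\<close>)
  then obtain c where "\<And>s. s \<in> ?S \<Longrightarrow> integral UNIV (\<lambda>y. u (x + s *\<^sub>R y) * cap y) = c"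
    using has_field_derivative_zero_constant[of ?S "\<lambda>s. integral UNIV (\<lambda>y. u (x + s *\<^sub>R y) * cap y)"]
    using der0 by auto
  from this[of R] this[of 0] R show ?thesis by simp
qed

section \<open>Mean value inequalities for the gradient\<close>

lemma inner_sgn_self: "v \<bullet> sgn v = norm (v :: 'a::real_inner)"
  by (cases "v = 0") (auto simp: sgn_div_norm dot_square_norm power2_eq_square)

lemma set_integrable_ball_continuous:
  fixes f :: "'a::euclidean_space \<Rightarrow> real"
  assumes "continuous_on (cball x r) f"
  shows "set_integrable lebesgue (ball x r) f"
proof (rule set_integrable_subset)
  have "integrable lborel (\<lambda>y. indicator (cball x r) y *\<^sub>R f y)"
    by (rule borel_integrable_compact[OF compact_cball assms])
  then show "set_integrable lebesgue (cball x r) f"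
    unfolding set_integrable_def
    by (subst integrable_completion) (auto dest: borel_measurable_integrable)
qed auto

text \<open>
  Moving the centre in the direction \<open>e\<close> of the gradient and differentiating the weighted mean
  value identity for radius \<open>R/2\<close> expresses \<open>|\<nabla>u(x)|\<close> as a weighted mean of \<open>\<nabla>u \<cdot> e\<close>. Half the
  radius leaves room for moving the centre.
\<close>

lemma gradient_sub_mean:
  fixes u :: "real ^ 'n \<Rightarrow> real"
  assumes u: "harmonic_on u \<Omega>" and sub: "cball x R \<subseteq> \<Omega>" and R: "0 < R"
  shows "norm (gradient u x) * integral UNIV (cap :: real ^ 'n \<Rightarrow> real) * (R / 2) ^ CARD('n)
    \<le> (LINT z:ball x R|lebesgue. norm (gradient u z))"
proof -
  define c where "c = integral UNIV (cap :: real ^ 'n \<Rightarrow> real)"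
  define \<rho> where "\<rho> = R / 2"
  define e where "e = sgn (gradient u x)"
  define g where "g z = norm (gradient u z)" for z
  have \<rho>: "0 < \<rho>" "\<rho> + \<rho> = R" using R by (auto simp: \<rho>_def)
  have e: "norm e \<le> 1" by (simp add: e_def norm_sgn)
  let ?U = "{-\<rho><..<\<rho>}"
  note contu = harmonic_on_continuous[OF u] and contg = harmonic_on_continuous_gradient[OF u]
  have te: "norm (t *\<^sub>R e) \<le> \<rho>" if "t \<in> ?U" for t
    using that e mult_mono[of "\<bar>t\<bar>" \<rho> "norm e" 1] by (auto simp: abs_le_iff)
  have \<rho>y: "norm (\<rho> *\<^sub>R y) \<le> \<rho>" if "norm y \<le> 1" for y :: "real ^ 'n"
    using that \<rho> by (simp add: mult_left_le)
  have mem: "x + t *\<^sub>R e + \<rho> *\<^sub>R y \<in> \<Omega>" if "t \<in> ?U" "norm y \<le> 1" for t y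
  proof -
    have "norm (t *\<^sub>R e + \<rho> *\<^sub>R y) \<le> \<rho> + \<rho>"
      using te[OF that(1)] \<rho>y[OF that(2)] norm_triangle_ineq[of "t *\<^sub>R e" "\<rho> *\<^sub>R y"] by linarith
    moreover have "dist x (x + t *\<^sub>R e + \<rho> *\<^sub>R y) = norm (t *\<^sub>R e + \<rho> *\<^sub>R y)"
    proof -
      have "x - (x + t *\<^sub>R e + \<rho> *\<^sub>R y) = - (t *\<^sub>R e + \<rho> *\<^sub>R y)" by simp
      then show ?thesis by (simp only: dist_norm norm_minus_cancel)
    qed
    ultimately have "x + t *\<^sub>R e + \<rho> *\<^sub>R y \<in> cball x R"
      using \<rho>(2) by (simp only: mem_cball)
    then show ?thesis using sub by blast
  qed
  have mem0: "x + \<rho> *\<^sub>R y \<in> \<Omega>" if "norm y \<le> 1" for y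
    using mem[of 0 y] that \<rho> by simp
  define fx where "fx t y = (gradient u (x + t *\<^sub>R e + \<rho> *\<^sub>R y) \<bullet> e) * cap y" for t y
  have "((\<lambda>t. integral UNIV (\<lambda>y. u (x + t *\<^sub>R e + \<rho> *\<^sub>R y) * cap y)) has_real_derivative
      integral UNIV (fx 0)) (at 0 within ?U)"
  proof (rule leibniz_rule_compact_support[where r=1])
    show "((\<lambda>t. u (x + t *\<^sub>R e + \<rho> *\<^sub>R y) * cap y) has_real_derivative fx t y) (at t within ?U)"
      if "t \<in> ?U" for t y
    proof (cases "norm y \<le> 1")
      case True
      have "((\<lambda>t. x + t *\<^sub>R e + \<rho> *\<^sub>R y) has_derivative (\<lambda>h. h *\<^sub>R e)) (at t)"
        by (auto intro!: derivative_eq_intros)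
      from has_derivative_compose[OF this harmonic_on_has_derivative[OF u mem[OF that True]]]
      have "((\<lambda>t. u (x + t *\<^sub>R e + \<rho> *\<^sub>R y)) has_real_derivative
          gradient u (x + t *\<^sub>R e + \<rho> *\<^sub>R y) \<bullet> e) (at t)"
        by (simp add: has_field_derivative_def mult_commute_abs)
      then show ?thesis
        unfolding fx_def by (rule DERIV_cmult_right[THEN has_field_derivative_at_within])
    qed (simp add: fx_def cap_eq_0)
    show "continuous_on UNIV (\<lambda>y. u (x + t *\<^sub>R e + \<rho> *\<^sub>R y) * cap y)" if "t \<in> ?U" for t
      by (rule continuous_on_mult_cutoff[where g="norm" and c=1])
         (use that in \<open>auto intro!: continuous_intros continuous_on_compose2[OF contu] mem simp: cap_eq_0\<close>)
    show "continuous_on (?U \<times> UNIV) (\<lambda>(t, y). fx t y)"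
      unfolding fx_def case_prod_unfold
      by (rule continuous_on_mult_cutoff[where g="\<lambda>z. norm (snd z)" and c=1])
         (auto intro!: continuous_intros continuous_on_compose2[OF contg] mem simp: cap_eq_0)
  qed (use \<rho> in \<open>auto simp: fx_def cap_eq_0\<close>)
  moreover have "((\<lambda>t. integral UNIV (\<lambda>y. u (x + t *\<^sub>R e + \<rho> *\<^sub>R y) * cap y)) has_real_derivative
      norm (gradient u x) * c) (at 0 within ?U)"
  proof (rule has_field_derivative_transform_within[where d=1])
    have "((\<lambda>t. x + t *\<^sub>R e) has_derivative (\<lambda>h. h *\<^sub>R e)) (at 0)"
      by (auto intro!: derivative_eq_intros)
    moreover have "(u has_derivative (\<lambda>h. gradient u x \<bullet> h)) (at (x + 0 *\<^sub>R e))"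
      using harmonic_on_has_derivative[OF u mem0[of 0]] by simp
    ultimately have "((\<lambda>t. u (x + t *\<^sub>R e)) has_derivative (\<lambda>h. gradient u x \<bullet> (h *\<^sub>R e))) (at 0)"
      by (rule has_derivative_compose)
    moreover have "(\<lambda>h. gradient u x \<bullet> (h *\<^sub>R e)) = (*) (norm (gradient u x))"
      by (auto simp: e_def inner_sgn_self)
    ultimately have "((\<lambda>t. u (x + t *\<^sub>R e)) has_real_derivative norm (gradient u x)) (at 0)"
      by (simp only: has_field_derivative_def)
    then show "((\<lambda>t. u (x + t *\<^sub>R e) * c) has_real_derivative norm (gradient u x) * c) (at 0 within ?U)"
      by (rule DERIV_cmult_right[THEN has_field_derivative_at_within])
    fix t assume "t \<in> ?U"
    have "cball (x + t *\<^sub>R e) \<rho> \<subseteq> cball x R"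
    proof
      fix z assume "z \<in> cball (x + t *\<^sub>R e) \<rho>"
      moreover have "dist x z \<le> dist x (x + t *\<^sub>R e) + dist (x + t *\<^sub>R e) z" by (rule dist_triangle)
      moreover have "dist x (x + t *\<^sub>R e) = norm (t *\<^sub>R e)" by (simp add: dist_norm)
      ultimately show "z \<in> cball x R" using te[OF \<open>t \<in> ?U\<close>] \<rho>(2) by (simp only: mem_cball)
    qed
    then show "u (x + t *\<^sub>R e) * c = integral UNIV (\<lambda>y. u (x + t *\<^sub>R e + \<rho> *\<^sub>R y) * cap y)"
      unfolding c_def using sub \<rho> by (intro harmonic_weighted_mean[OF u, symmetric]) auto
  qed (use \<rho> in auto)
  moreover have at0: "at 0 within ?U = at 0" using \<rho> by (intro at_within_open) auto
  ultimately have grad: "norm (gradient u x) * c = integral UNIV (fx 0)"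
    unfolding at0 by (intro DERIV_unique)

  \<comment> \<open>the integrand in the variables of the ball of radius \<open>\<rho>\<close> about \<open>x\<close>\<close>
  define k where "k z = g z * cap ((1 / \<rho>) *\<^sub>R (z - x))" for z
  have k0: "k z = 0" if "\<rho> \<le> dist x z" for z
    using that \<rho> by (simp add: k_def cap_eq_0 dist_norm norm_minus_commute)
  have kcont: "continuous_on UNIV k" unfolding k_def g_def
  proof (rule continuous_on_mult_cutoff[where g="dist x" and c=\<rho>])
    show "continuous_on {z \<in> UNIV. dist x z \<le> \<rho>} (\<lambda>z. norm (gradient u z))"
      by (intro continuous_intros continuous_on_subset[OF contg]) (use sub \<rho> in auto)
    show "cap ((1 / \<rho>) *\<^sub>R (z - x)) = 0" if "\<rho> \<le> dist x z" for z
      using that \<rho> by (simp add: cap_eq_0 dist_norm norm_minus_commute)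
  qed (intro continuous_intros)+
  have supp: "k z = 0" if "norm x + \<rho> < norm z" for z
    using that norm_triangle_sub[of z x] by (intro k0) (simp add: dist_norm norm_minus_commute)
  have kint: "k integrable_on UNIV" by (rule integrable_compact_support[OF kcont supp])
  have scaled: "((\<lambda>y. k (\<rho> *\<^sub>R y + x)) has_integral integral UNIV k / \<bar>\<rho>\<bar> ^ DIM(real ^ 'n)) UNIV"
  proof (rule has_integral_affine_UNIV[OF integrable_integral[OF kint]])
    show "bounded {z. k z \<noteq> 0}"
      by (rule bounded_subset[OF bounded_cball[of x \<rho>]]) (use k0 in \<open>force simp: not_le[symmetric]\<close>)
  qed (use \<rho> in auto)
  have "norm (gradient u x) * c \<le> integral UNIV (\<lambda>y. k (\<rho> *\<^sub>R y + x))"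
    unfolding grad
  proof (rule integral_le)
    show "fx 0 integrable_on UNIV"
    proof (rule integrable_compact_support[where r=1])
      show "continuous_on UNIV (fx 0)" unfolding fx_def
        by (rule continuous_on_mult_cutoff[where g="norm" and c=1])
           (auto intro!: continuous_intros continuous_on_compose2[OF contg] mem0 simp: cap_eq_0)
    qed (simp add: fx_def cap_eq_0)
    show "fx 0 y \<le> k (\<rho> *\<^sub>R y + x)" for y
    proof -
      have "gradient u (x + \<rho> *\<^sub>R y) \<bullet> e \<le> norm (gradient u (x + \<rho> *\<^sub>R y)) * norm e"
        by (rule norm_cauchy_schwarz)
      also have "\<dots> \<le> g (x + \<rho> *\<^sub>R y)" using e by (simp add: g_def mult_left_le)
      finally show ?thesis
        using \<rho> by (simp add: fx_def k_def add.commute mult_right_mono cap_nonneg)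
    qed
  qed (use scaled in auto)
  also have "\<dots> = integral UNIV k / \<rho> ^ CARD('n)"
    using integral_unique[OF scaled] \<rho> by simp
  finally have 1: "norm (gradient u x) * c * \<rho> ^ CARD('n) \<le> integral UNIV k"
    using \<rho> by (simp add: pos_le_divide_eq)
  have gint: "set_integrable lebesgue (ball x R) g"
    unfolding g_def
    by (rule set_integrable_ball_continuous) (intro continuous_intros continuous_on_subset[OF contg] sub)
  have "integral UNIV k = integral UNIV (\<lambda>z. if z \<in> ball x R then k z else 0)"
    using k0 \<rho> by (intro integral_cong) auto
  also have "\<dots> = integral (ball x R) k" by (rule integral_restrict_UNIV)
  also have "\<dots> \<le> integral (ball x R) g"
  proof (rule integral_le)
    have "(\<lambda>z. if z \<in> ball x R then k z else 0) = k" using k0 \<rho> by auto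
    then show "k integrable_on ball x R"
      using kint integrable_restrict_UNIV[of "ball x R" k] by simp
    show "g integrable_on ball x R"
      by (rule set_lebesgue_integral_eq_integral(1)[OF gint])
    show "k z \<le> g z" for z
      by (simp add: k_def g_def mult_left_le cap_le_1)
  qed
  also have "\<dots> = (LINT z:ball x R|lebesgue. g z)"
    by (rule set_lebesgue_integral_eq_integral(2)[OF gint, symmetric])
  finally show ?thesis using 1 unfolding c_def \<rho>_def g_def by linarith
qed

text \<open>
  For small \<open>p\<close> the mean of \<open>w\<close> is not controlled by the \<open>p\<close>-mean unless the supremum of \<open>w\<close> is.
  Maximising \<open>w(y) \<sigma>\<^bsup>n/p\<^esup>\<close>, where \<open>\<sigma> = \<rho> - |x - y|\<close> is the distance of \<open>y\<close> to the sphere of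
  radius \<open>\<rho>\<close>, selects a point \<open>y\<close> such that \<open>w \<le> S w(y)\<close> with \<open>S = 2\<^bsup>n/p\<^esup>\<close> throughout the ball
  of radius \<open>\<sigma>/2\<close> about \<open>y\<close>. There, for every threshold \<open>\<kappa> > 0\<close>,
  \<open>w \<le> \<kappa> + S w(y) (w/\<kappa>)\<^bsup>p\<^esup>\<close>: either \<open>w \<le> \<kappa>\<close>, or the last factor is at least \<open>1\<close>.
  With \<open>\<kappa> = w(y)/(2 A)\<close> the constant term takes up only half of \<open>w(y)\<close> in the mean value
  inequality and can be absorbed, which leaves a bound for \<open>w(y)\<^bsup>p\<^esup>\<close> in terms of the integral of
  \<open>w\<^bsup>p\<^esup>\<close>. The exponent \<open>n/p\<close> is the one for which the bound at \<open>y\<close> transfers to \<open>x\<close> without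
  any power of \<open>\<sigma>\<close> left over.
\<close>

lemma power_mean_of_sub_mean:
  fixes w :: "real ^ 'n \<Rightarrow> real"
  assumes cont: "continuous_on (cball x \<rho>) w" and nonneg: "\<And>y. y \<in> cball x \<rho> \<Longrightarrow> 0 \<le> w y"
    and mean: "\<And>y r. 0 < r \<Longrightarrow> cball y r \<subseteq> cball x \<rho> \<Longrightarrow>
      w y * measure lebesgue (ball y r) \<le> A * (LINT z:ball y r|lebesgue. w z)"
    and A: "0 < A" and p: "0 < p" and \<rho>: "0 < \<rho>"
  shows "w x powr p * measure lebesgue (ball x \<rho>) \<le>
    2 * 2 ^ CARD('n) * A * 2 powr (real CARD('n) / p) * (2 * A) powr p *
      (LINT z:ball x \<rho>|lebesgue. w z powr p)"
proof (cases "w x = 0")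
  case True
  have "0 \<le> (LINT z:ball x \<rho>|lebesgue. w z powr p)"
    unfolding set_lebesgue_integral_def by (rule Bochner_Integration.integral_nonneg) auto
  then show ?thesis using True A by simp
next
  case False
  then have wx: "0 < w x" using nonneg[of x] \<rho> by (simp add: less_le)
  define n where "n = CARD('n)"
  define \<beta> where "\<beta> = real n / p"
  define S where "S = 2 powr \<beta>"
  have S: "0 < S" by (simp add: S_def)
  have \<beta>: "0 \<le> \<beta>" using p by (simp add: \<beta>_def)
  have \<beta>p: "(s powr \<beta>) powr p = s ^ n" if "0 < s" for s :: real
  proof -
    have "(s powr \<beta>) powr p = s powr real n" using p by (simp only: powr_powr \<beta>_def) simp
    then show ?thesis using that by (simp add: powr_realpow)
  qed
  define v where "v y = w y * (\<rho> - dist x y) powr \<beta>" for y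
  have "continuous_on (cball x \<rho>) v"
    unfolding v_def
    by (intro continuous_on_mult cont continuous_on_powr' continuous_intros)
       (auto simp: \<beta>_def n_def p)
  then obtain y where y: "y \<in> cball x \<rho>" and max: "\<And>z. z \<in> cball x \<rho> \<Longrightarrow> v z \<le> v y"
    using continuous_attains_sup[of "cball x \<rho>" v] \<rho> by (auto simp: less_imp_le)
  define \<sigma> where "\<sigma> = \<rho> - dist x y"
  have vx: "v x \<le> v y" using max[of x] \<rho> by simp
  moreover have "0 < v x" using wx \<rho> by (simp add: v_def)
  ultimately have "0 < v y" by linarith
  then have wy: "0 < w y" and \<sigma>: "0 < \<sigma>"
    using nonneg[OF y] y by (auto simp: v_def \<sigma>_def zero_less_mult_iff)
  define r where "r = \<sigma> / 2"
  have r: "0 < r" using \<sigma> by (simp add: r_def)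
  have sub: "cball y r \<subseteq> cball x \<rho>"
  proof
    fix z assume "z \<in> cball y r"
    then show "z \<in> cball x \<rho>" using dist_triangle[of x z y] \<sigma> by (simp add: r_def \<sigma>_def)
  qed
  have bound: "w z \<le> S * w y" if z: "z \<in> cball y r" for z
  proof -
    have "r \<le> \<rho> - dist x z" using dist_triangle[of x z y] z by (simp add: r_def \<sigma>_def)
    then have "w z * r powr \<beta> \<le> v z"
      unfolding v_def using nonneg[of z] sub z r \<beta> by (intro mult_left_mono powr_mono2) auto
    also have "\<dots> \<le> v y" using max sub z by auto
    also have "v y = w y * (S * r powr \<beta>)"
      using \<sigma> by (simp add: v_def \<sigma>_def[symmetric] S_def r_def powr_divide)
    finally show ?thesis using r by (simp add: mult_ac)
  qed
  define V where "V = measure lebesgue (ball y r)"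
  define J where "J = (LINT z:ball y r|lebesgue. w z powr p)"
  define \<kappa> where "\<kappa> = w y / (2 * A)"
  have \<kappa>: "0 < \<kappa>" using wy A by (simp add: \<kappa>_def)
  have intp: "set_integrable lebesgue (ball z s) (\<lambda>z. w z powr p)" if "cball z s \<subseteq> cball x \<rho>" for z s
    using that nonneg p
    by (intro set_integrable_ball_continuous continuous_on_powr' continuous_on_subset[OF cont] continuous_intros) auto
  have int1: "set_integrable lebesgue (ball y r) w"
    by (intro set_integrable_ball_continuous continuous_on_subset[OF cont] sub)
  have intc: "set_integrable lebesgue (ball y r) (\<lambda>_. \<kappa>)"
    by (intro set_integrable_ball_continuous continuous_intros)
  have "w y * V \<le> A * (LINT z:ball y r|lebesgue. w z)"
    unfolding V_def by (rule mean[OF r sub])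
  also have "\<dots> \<le> A * (LINT z:ball y r|lebesgue. \<kappa> + S * w y / \<kappa> powr p * w z powr p)"
  proof (intro mult_left_mono set_integral_mono int1)
    show "set_integrable lebesgue (ball y r) (\<lambda>z. \<kappa> + S * w y / \<kappa> powr p * w z powr p)"
      by (intro set_integral_add intc set_integrable_mult_right impI intp sub)
    show "w z \<le> \<kappa> + S * w y / \<kappa> powr p * w z powr p" if z: "z \<in> ball y r" for z
    proof (cases "w z \<le> \<kappa>")
      case True
      have "0 \<le> S * w y / \<kappa> powr p * w z powr p" using S wy by simp
      then show ?thesis using True by linarith
    next
      case False
      have "w z \<le> S * w y * 1" using bound z by simp
      also have "\<dots> \<le> S * w y * (w z powr p / \<kappa> powr p)"
        using False \<kappa> S wy p by (intro mult_left_mono) (auto simp: le_divide_eq intro!: powr_mono2)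
      finally show ?thesis using \<kappa> by (simp add: mult_ac)
    qed
  qed (use A in auto)
  also have "(LINT z:ball y r|lebesgue. \<kappa> + S * w y / \<kappa> powr p * w z powr p) =
      \<kappa> * V + S * w y / \<kappa> powr p * J"
  proof -
    have "(LINT z:ball y r|lebesgue. \<kappa>) = V * \<kappa>"
      using emeasure_lborel_ball_finite[of y r] by (subst set_integral_const) (auto simp: V_def)
    then show ?thesis
      unfolding J_def by (subst set_integral_add) (auto intro!: intc intp sub)
  qed
  also have "A * \<dots> = w y * V / 2 + A * S * w y * (2 * A) powr p / w y powr p * J"
    using A wy by (simp add: \<kappa>_def powr_divide field_simps)
  finally have "w y * V \<le> w y * (2 * A * S * (2 * A) powr p / w y powr p * J)"
    by (simp add: field_simps)
  then have "V \<le> 2 * A * S * (2 * A) powr p / w y powr p * J"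
    using wy by (rule mult_left_le_imp_le)
  then have main: "w y powr p * V \<le> 2 * A * S * (2 * A) powr p * J"
    using wy by (simp add: field_simps)

  have "w x powr p * measure lebesgue (ball x \<rho>) = unit_ball_vol n * v x powr p"
    using \<rho> wx \<beta>p[OF \<rho>] by (simp add: content_ball v_def powr_mult n_def mult_ac)
  also have "\<dots> \<le> unit_ball_vol n * v y powr p"
    using vx \<open>0 < v x\<close> p by (intro mult_left_mono powr_mono2) (auto simp: unit_ball_vol_nonneg)
  also have "\<dots> = 2 ^ n * (w y powr p * V)"
    using \<sigma> wy r \<beta>p[OF \<sigma>]
    by (simp add: V_def content_ball v_def \<sigma>_def[symmetric] powr_mult n_def r_def mult_ac power_divide)
  also have "\<dots> \<le> 2 ^ n * (2 * A * S * (2 * A) powr p * J)"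
    using main by (intro mult_left_mono) auto
  also have "\<dots> \<le> 2 ^ n * (2 * A * S * (2 * A) powr p * (LINT z:ball x \<rho>|lebesgue. w z powr p))"
  proof (intro mult_left_mono)
    have "ball y r \<subseteq> ball x \<rho>"
      using sub interior_mono[OF sub] by simp
    then show "J \<le> (LINT z:ball x \<rho>|lebesgue. w z powr p)"
      using intp[OF sub] intp[of x \<rho>]
      unfolding J_def set_integrable_def set_lebesgue_integral_def
      by (intro integral_mono) (auto simp: indicator_def)
  qed (use A S in auto)
  finally show ?thesis by (simp add: n_def S_def \<beta>_def mult_ac)
qed

text \<open>
  The constant \<open>A\<close> collects the volume of the ball and the total mass of the weight, so that the
  mean value inequality for the gradient takes the form that the passage to other exponents needs.
\<close>

lemma norm_gradient_le_power_mean: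
  fixes u :: "real ^ 'n \<Rightarrow> real"
  assumes u: "harmonic_on u \<Omega>" and p: "0 < p"
  obtains K where "0 < K" "\<And>x \<rho>. 0 < \<rho> \<Longrightarrow> cball x \<rho> \<subseteq> \<Omega> \<Longrightarrow>
    norm (gradient u x) \<le> K * (1 / measure lebesgue (ball x \<rho>) *
      (LINT y:ball x \<rho>|lebesgue. norm (gradient u y) powr p)) powr (1 / p)"
proof -
  define c where "c = integral UNIV (cap :: real ^ 'n \<Rightarrow> real)"
  have c: "0 < c" unfolding c_def by (rule integral_cap_pos)
  define A where "A = unit_ball_vol CARD('n) * 2 ^ CARD('n) / c"
  have A: "0 < A" using c by (simp add: A_def)
  define B where "B = 2 * 2 ^ CARD('n) * A * 2 powr (real CARD('n) / p) * (2 * A) powr p"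
  have B: "0 < B" using A by (simp add: B_def)
  let ?w = "\<lambda>y. norm (gradient u y)"
  show ?thesis
  proof (rule that[of "B powr (1 / p)"])
    fix x \<rho> assume \<rho>: "0 < \<rho>" and sub: "cball x \<rho> \<subseteq> \<Omega>"
    define m where "m = measure lebesgue (ball x \<rho>)"
    define J where "J = (LINT y:ball x \<rho>|lebesgue. ?w y powr p)"
    have m: "0 < m" using \<rho> by (simp add: m_def content_ball)
    have J: "0 \<le> J"
      unfolding J_def set_lebesgue_integral_def by (rule Bochner_Integration.integral_nonneg) auto
    have "?w x powr p * m \<le> B * J"
      unfolding m_def J_def B_def
    proof (rule power_mean_of_sub_mean[OF _ _ _ A p \<rho>])
      show "continuous_on (cball x \<rho>) ?w"
        by (intro continuous_intros continuous_on_subset[OF harmonic_on_continuous_gradient[OF u]] sub)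
      fix y r assume r: "0 < r" and "cball y r \<subseteq> cball x \<rho>"
      then have "cball y r \<subseteq> \<Omega>" using sub by blast
      have "?w y * measure lebesgue (ball y r) = A * (?w y * c * (r / 2) ^ CARD('n))"
        using r c by (simp add: content_ball A_def power_divide)
      also have "\<dots> \<le> A * (LINT z:ball y r|lebesgue. ?w z)"
        using A unfolding c_def
        by (intro mult_left_mono gradient_sub_mean[OF u \<open>cball y r \<subseteq> \<Omega>\<close> r]) auto
      finally show "?w y * measure lebesgue (ball y r) \<le> A * (LINT z:ball y r|lebesgue. ?w z)" .
    qed auto
    then have "?w x powr p \<le> B * (1 / m * J)" using m by (simp add: pos_le_divide_eq)
    then have "(?w x powr p) powr (1 / p) \<le> (B * (1 / m * J)) powr (1 / p)"
      using p by (intro powr_mono2) auto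
    also have "(?w x powr p) powr (1 / p) = ?w x" using p by (simp add: powr_powr)
    also have "(B * (1 / m * J)) powr (1 / p) = B powr (1 / p) * (1 / m * J) powr (1 / p)"
      by (rule powr_mult)
    finally show "?w x \<le> B powr (1 / p) * (1 / measure lebesgue (ball x \<rho>) *
        (LINT y:ball x \<rho>|lebesgue. ?w y powr p)) powr (1 / p)"
      unfolding m_def J_def .
  qed (use B in auto)
qed

lemma power_mean_le:
  fixes w :: "real ^ 'n \<Rightarrow> real"
  assumes cont: "continuous_on (cball x \<rho>) w" and w: "\<And>y. y \<in> cball x \<rho> \<Longrightarrow> 0 \<le> w y \<and> w y \<le> M"
    and p: "0 < p" and \<rho>: "0 < \<rho>"
  shows "(1 / measure lebesgue (ball x \<rho>) * (LINT y:ball x \<rho>|lebesgue. w y powr p)) powr (1 / p) \<le> M"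
proof -
  define m where "m = measure lebesgue (ball x \<rho>)"
  have m: "0 < m" using \<rho> by (simp add: m_def content_ball)
  have M: "0 \<le> M" using w[of x] \<rho> by auto
  have "(LINT y:ball x \<rho>|lebesgue. w y powr p) \<le> (LINT y:ball x \<rho>|lebesgue. M powr p)"
  proof (rule set_integral_mono)
    show "set_integrable lebesgue (ball x \<rho>) (\<lambda>y. w y powr p)"
      using p w by (intro set_integrable_ball_continuous continuous_on_powr' cont continuous_intros) auto
    show "set_integrable lebesgue (ball x \<rho>) (\<lambda>y. M powr p)"
      by (intro set_integrable_ball_continuous continuous_intros)
    show "w y powr p \<le> M powr p" if "y \<in> ball x \<rho>" for y
      using w[of y] that p by (intro powr_mono2) auto
  qed
  also have "\<dots> = m * M powr p"
    using emeasure_lborel_ball_finite[of x \<rho>] by (subst set_integral_const) (auto simp: m_def)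
  finally have "1 / m * (LINT y:ball x \<rho>|lebesgue. w y powr p) \<le> M powr p"
    using m by (simp add: pos_divide_le_eq mult.commute)
  moreover have "0 \<le> 1 / m * (LINT y:ball x \<rho>|lebesgue. w y powr p)"
    unfolding set_lebesgue_integral_def using m
    by (intro mult_nonneg_nonneg Bochner_Integration.integral_nonneg) auto
  ultimately have "(1 / m * (LINT y:ball x \<rho>|lebesgue. w y powr p)) powr (1 / p) \<le> (M powr p) powr (1 / p)"
    using p by (intro powr_mono2) auto
  then show ?thesis using M p by (simp add: powr_powr m_def)
qed

section \<open>Local comparison of the internal and the Euclidean metric\<close>

definition internal_density :: "(real \<Rightarrow> real) \<Rightarrow> 'a::metric_space set \<Rightarrow> 'a \<Rightarrow> real" where
  "internal_density \<psi> \<Omega> x = \<psi> (infdist x (frontier \<Omega>)) / infdist x (frontier \<Omega>)"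

lemma internal_density_nonneg: "majorant \<psi> \<Longrightarrow> 0 \<le> internal_density \<psi> \<Omega> x"
  by (auto simp: internal_density_def majorant_def infdist_nonneg)

context
  fixes \<Omega> :: "'a::euclidean_space set"
  assumes open_\<Omega>: "open \<Omega>" and bounded_\<Omega>: "bounded \<Omega>"
begin

lemma frontier_nonempty: "x \<in> \<Omega> \<Longrightarrow> frontier \<Omega> \<noteq> {}"
  using bounded_\<Omega> not_bounded_UNIV by (auto simp: frontier_eq_empty)

lemma infdist_frontier_pos:
  assumes "x \<in> \<Omega>"
  shows "0 < infdist x (frontier \<Omega>)"
proof -
  have "x \<notin> frontier \<Omega>" using assms open_\<Omega> by (simp add: frontier_def interior_open)
  then show ?thesis using frontier_nonempty[OF assms] by (intro infdist_pos_not_in_closed) auto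
qed

lemma ball_infdist_frontier_subset:
  assumes "x \<in> \<Omega>"
  shows "ball x (infdist x (frontier \<Omega>)) \<subseteq> \<Omega>"
proof (rule ccontr)
  assume "\<not> ?thesis"
  then have "ball x (infdist x (frontier \<Omega>)) - \<Omega> \<noteq> {}" by blast
  moreover have "ball x (infdist x (frontier \<Omega>)) \<inter> \<Omega> \<noteq> {}"
    using assms infdist_frontier_pos[OF assms] centre_in_ball by blast
  ultimately have "ball x (infdist x (frontier \<Omega>)) \<inter> frontier \<Omega> \<noteq> {}"
    by (intro connected_Int_frontier) auto
  then show False using infdist_le[of _ "frontier \<Omega>" x] by fastforce
qed

lemma cball_half_infdist_subset:
  assumes "x \<in> \<Omega>"
  shows "cball x (infdist x (frontier \<Omega>) / 2) \<subseteq> \<Omega>"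
  using ball_infdist_frontier_subset[OF assms] infdist_frontier_pos[OF assms] by (auto simp: subset_iff)

text \<open>
  At \<open>y\<close> the distance to the boundary is at least \<open>d/2\<close>, and
  \<open>\<psi>(d(y))/d(y) \<le> \<psi>(d/2)/(d/2) \<le> 2 \<psi>(d)/d\<close> because \<open>\<psi>(t)/t\<close> decreases and \<open>\<psi>\<close> increases.
\<close>

lemma internal_density_le_twice:
  assumes \<psi>: "majorant \<psi>" and x: "x \<in> \<Omega>" and y: "y \<in> cball x (infdist x (frontier \<Omega>) / 2)"
  shows "internal_density \<psi> \<Omega> y \<le> 2 * internal_density \<psi> \<Omega> x"
proof -
  define d where "d = infdist x (frontier \<Omega>)"
  have d: "0 < d" using infdist_frontier_pos[OF x] by (simp add: d_def)
  have "d / 2 \<le> infdist y (frontier \<Omega>)"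
    using infdist_triangle[of x "frontier \<Omega>" y] y by (simp add: d_def)
  then have "internal_density \<psi> \<Omega> y \<le> \<psi> (d / 2) / (d / 2)"
    using \<psi> d monotone_onD[of "{0<..}" "(\<le>)" "(\<ge>)" "\<lambda>t. \<psi> t / t" "d / 2" "infdist y (frontier \<Omega>)"]
    by (simp add: internal_density_def majorant_def)
  also have "\<dots> \<le> \<psi> d / (d / 2)"
    using \<psi> d unfolding majorant_def mono_on_def by (intro divide_right_mono) auto
  finally show ?thesis by (simp add: internal_density_def d_def[symmetric] mult.commute)
qed

lemma continuous_on_internal_density:
  assumes "majorant \<psi>"
  shows "continuous_on \<Omega> (internal_density \<psi> \<Omega>)"
proof -
  have "continuous_on {0..} \<psi>" using assms by (simp add: majorant_def)
  moreover have "continuous_on \<Omega> (\<lambda>x. infdist x (frontier \<Omega>))" by (intro continuous_intros)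
  ultimately have "continuous_on \<Omega> (\<lambda>x. \<psi> (infdist x (frontier \<Omega>)))"
    by (rule continuous_on_compose2) (auto simp: infdist_nonneg)
  then show ?thesis
    unfolding internal_density_def
    by (intro continuous_intros) (use infdist_frontier_pos in force)+
qed

lemma int_dist_le_segment:
  assumes \<psi>: "majorant \<psi>" and sub: "closed_segment x y \<subseteq> \<Omega>"
    and M: "\<And>z. z \<in> closed_segment x y \<Longrightarrow> internal_density \<psi> \<Omega> z \<le> M"
  shows "int_dist \<psi> \<Omega> x y \<le> M * norm (y - x)"
proof -
  let ?\<gamma> = "linepath x y"
  have lip: "(norm (y - x))-lipschitz_on {0..1} ?\<gamma>"
  proof (rule lipschitz_onI)
    show "dist (?\<gamma> s) (?\<gamma> t) \<le> norm (y - x) * dist s t" for s t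
    proof -
      have "?\<gamma> s - ?\<gamma> t = (s - t) *\<^sub>R (y - x)" by (simp add: linepath_def algebra_simps)
      then show ?thesis by (simp add: dist_norm mult.commute)
    qed
  qed auto
  note rect = lipschitz_path_rectifiable[OF lip]
  have M0: "0 \<le> M" using M[of x] internal_density_nonneg[OF \<psi>, of \<Omega> x] by simp
  let ?I = "integral {0..arc_length ?\<gamma> 0 1} (\<lambda>s. internal_density \<psi> \<Omega> (arc_length_param ?\<gamma> s))"
  have nonneg: "0 \<le> arc_integral \<gamma> (internal_density \<psi> \<Omega>)" for \<gamma>
    unfolding arc_integral_def
    by (cases "(\<lambda>s. internal_density \<psi> \<Omega> (arc_length_param \<gamma> s)) integrable_on {0..arc_length \<gamma> 0 1}")
       (auto intro: integral_nonneg internal_density_nonneg[OF \<psi>] simp: not_integrable_integral)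
  have "int_dist \<psi> \<Omega> x y \<le> arc_integral ?\<gamma> (internal_density \<psi> \<Omega>)"
    unfolding int_dist_def internal_density_def[symmetric]
  proof (rule cInf_lower)
    show "bdd_below {arc_integral \<gamma> (internal_density \<psi> \<Omega>) |\<gamma>.
        rectifiable_path \<gamma> \<and> path_image \<gamma> \<subseteq> \<Omega> \<and> pathstart \<gamma> = x \<and> pathfinish \<gamma> = y}"
      using nonneg by (intro bdd_belowI[of _ 0]) auto
  qed (use rect(1) sub in \<open>auto intro!: exI[of _ ?\<gamma>]\<close>)
  also have "\<dots> \<le> M * norm (y - x)"
  proof (cases "(\<lambda>s. internal_density \<psi> \<Omega> (arc_length_param ?\<gamma> s)) integrable_on {0..arc_length ?\<gamma> 0 1}")
    case True
    have "?I \<le> integral {0..arc_length ?\<gamma> 0 1} (\<lambda>s. M)"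
    proof (rule integral_le[OF True])
      fix s assume "s \<in> {0..arc_length ?\<gamma> 0 1}"
      then obtain t where "t \<in> {0..1}" "arc_length_param ?\<gamma> s = ?\<gamma> t"
        using arc_length_param_eq[OF rect(1)] by metis
      then show "internal_density \<psi> \<Omega> (arc_length_param ?\<gamma> s) \<le> M"
        using M[of "?\<gamma> t"] path_image_linepath[of x y] by (metis imageI path_image_def)
    qed auto
    also have "\<dots> = M * arc_length ?\<gamma> 0 1"
      using arc_length_param_endpoints(3)[OF rect(1)] by simp
    also have "\<dots> \<le> M * norm (y - x)" by (rule mult_left_mono[OF rect(2) M0])
    finally show ?thesis by (simp add: arc_integral_def)
  next
    case False
    then show ?thesis using M0 by (simp add: arc_integral_def not_integrable_integral)
  qed
  finally show ?thesis .
qed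

text \<open>
  On the half-ball about \<open>x\<close> the internal distance is at most the integral of the density along
  the segment, and there the density is comparable to its value at \<open>x\<close>.
\<close>

lemma lipschitz_int_locally_lipschitz:
  fixes F :: "'a \<Rightarrow> real"
  assumes \<psi>: "majorant \<psi>" and F: "F \<in> lipschitz_int \<psi> \<Omega>"
  obtains C where "0 < C" "\<And>x. x \<in> \<Omega> \<Longrightarrow>
    \<forall>\<^sub>F y in nhds x. \<bar>F y - F x\<bar> \<le> C * internal_density \<psi> \<Omega> x * norm (y - x)"
proof -
  obtain C where C: "0 < C" "\<And>x y. x \<in> \<Omega> \<Longrightarrow> y \<in> \<Omega> \<Longrightarrow> norm (F x - F y) \<le> C * int_dist \<psi> \<Omega> x y"
    using F by (auto simp: lipschitz_int_def)
  show ?thesis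
  proof (rule that[of "2 * C"])
    fix x assume x: "x \<in> \<Omega>"
    define d where "d = infdist x (frontier \<Omega>)"
    have d: "0 < d" using infdist_frontier_pos[OF x] by (simp add: d_def)
    have "\<forall>\<^sub>F y in nhds x. y \<in> ball x (d / 2)"
      using d by (intro eventually_nhds_in_open) auto
    then show "\<forall>\<^sub>F y in nhds x. \<bar>F y - F x\<bar> \<le> 2 * C * internal_density \<psi> \<Omega> x * norm (y - x)"
    proof eventually_elim
      fix y assume y: "y \<in> ball x (d / 2)"
      have seg: "closed_segment x y \<subseteq> cball x (d / 2)"
        using y d by (intro closed_segment_subset) auto
      have "int_dist \<psi> \<Omega> x y \<le> 2 * internal_density \<psi> \<Omega> x * norm (y - x)"
        using seg cball_half_infdist_subset[OF x] internal_density_le_twice[OF \<psi> x]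
        by (intro int_dist_le_segment[OF \<psi>]) (auto simp: d_def)
      moreover have "y \<in> \<Omega>" using seg cball_half_infdist_subset[OF x] by (auto simp: d_def)
      ultimately have "\<bar>F x - F y\<bar> \<le> C * (2 * internal_density \<psi> \<Omega> x * norm (y - x))"
        using C(2)[OF x, of y] C(1) by (smt (verit) mult_left_mono real_norm_def)
      then show "\<bar>F y - F x\<bar> \<le> 2 * C * internal_density \<psi> \<Omega> x * norm (y - x)"
        by (simp add: abs_minus_commute mult_ac)
    qed
  qed (use C in auto)
qed

text \<open>
  The infimum that defines the internal distance is meaningful only if some rectifiable curve joins
  the two points. Polynomial curves do so in a connected open set, and they are Lipschitz.
\<close>

lemma lipschitz_intI_derivative_bound:
  fixes u :: "'a \<Rightarrow> real"
  assumes conn: "connected \<Omega>" and \<psi>: "majorant \<psi>" and C: "0 < C"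
    and u: "\<And>x. x \<in> \<Omega> \<Longrightarrow> (u has_derivative D x) (at x)"
    and D: "\<And>x h. x \<in> \<Omega> \<Longrightarrow> \<bar>D x h\<bar> \<le> C * internal_density \<psi> \<Omega> x * norm h"
  shows "u \<in> lipschitz_int \<psi> \<Omega>"
proof -
  have "\<bar>u x - u y\<bar> / C \<le> int_dist \<psi> \<Omega> x y" if xy: "x \<in> \<Omega>" "y \<in> \<Omega>" for x y
    unfolding int_dist_def internal_density_def[symmetric]
  proof (rule cInf_greatest)
    obtain \<gamma> where \<gamma>: "polynomial_function \<gamma>" "path_image \<gamma> \<subseteq> \<Omega>" "pathstart \<gamma> = x" "pathfinish \<gamma> = y"
      using connected_open_polynomial_connected[OF open_\<Omega> conn xy] by blast
    obtain \<gamma>' where \<gamma>': "polynomial_function \<gamma>'" "\<And>t. (\<gamma> has_vector_derivative \<gamma>' t) (at t)"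
      using has_vector_derivative_polynomial_function[OF \<gamma>(1)] by metis
    have "bounded (\<gamma>' ` {0..1})"
      by (intro compact_imp_bounded compact_continuous_image continuous_on_polymonial_function \<gamma>') auto
    then obtain K where K: "\<And>t. t \<in> {0..1} \<Longrightarrow> norm (\<gamma>' t) \<le> K" unfolding bounded_iff by blast
    have "K-lipschitz_on {0..1} \<gamma>"
    proof (rule bounded_derivative_imp_lipschitz)
      show "(\<gamma> has_derivative (\<lambda>h. h *\<^sub>R \<gamma>' t)) (at t within {0..1})" for t
        using \<gamma>'(2)[of t] by (auto simp: has_vector_derivative_def intro: has_derivative_at_withinI)
      show "onorm (\<lambda>h. h *\<^sub>R \<gamma>' t) \<le> K" if "t \<in> {0..1}" for t
      proof (rule onorm_le)
        fix h :: real
        have "\<bar>h\<bar> * norm (\<gamma>' t) \<le> \<bar>h\<bar> * K" by (rule mult_left_mono[OF K[OF that] abs_ge_zero])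
        then show "norm (h *\<^sub>R \<gamma>' t) \<le> K * norm h" by (simp add: mult.commute)
      qed
      show "0 \<le> K" by (rule order_trans[OF norm_ge_zero K[of 0]]) simp
    qed auto
    then show "{arc_integral \<gamma> (internal_density \<psi> \<Omega>) |\<gamma>.
        rectifiable_path \<gamma> \<and> path_image \<gamma> \<subseteq> \<Omega> \<and> pathstart \<gamma> = x \<and> pathfinish \<gamma> = y} \<noteq> {}"
      using lipschitz_path_rectifiable(1) \<gamma> by blast
  next
    fix I assume "I \<in> {arc_integral \<gamma> (internal_density \<psi> \<Omega>) |\<gamma>.
        rectifiable_path \<gamma> \<and> path_image \<gamma> \<subseteq> \<Omega> \<and> pathstart \<gamma> = x \<and> pathfinish \<gamma> = y}"
    then obtain \<gamma> where \<gamma>: "I = arc_integral \<gamma> (internal_density \<psi> \<Omega>)" "rectifiable_path \<gamma>"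
      "path_image \<gamma> \<subseteq> \<Omega>" "pathstart \<gamma> = x" "pathfinish \<gamma> = y" by blast
    have "\<bar>u y - u x\<bar> \<le> arc_integral \<gamma> (\<lambda>x. C * internal_density \<psi> \<Omega> x)"
      unfolding \<gamma>(4,5)[symmetric]
    proof (rule abs_diff_le_arc_integral[OF \<gamma>(2,3) u D])
      show "0 \<le> C * internal_density \<psi> \<Omega> x" for x
        using C internal_density_nonneg[OF \<psi>, of \<Omega> x] by simp
    qed (auto intro!: continuous_intros continuous_on_internal_density \<psi>)
    also have "\<dots> = C * I" by (simp add: \<gamma>(1) arc_integral_def)
    finally show "\<bar>u x - u y\<bar> / C \<le> I"
      using C by (simp add: pos_divide_le_eq mult.commute abs_minus_commute)
  qed
  then show ?thesis
    unfolding lipschitz_int_def using C by (auto simp: pos_divide_le_eq mult.commute intro!: exI[of _ C])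
qed

end

lemma abs_diff_abs_eventually_eq:
  fixes u :: "'a::t2_space \<Rightarrow> real"
  assumes "isCont u x"
  shows "\<forall>\<^sub>F y in nhds x. \<bar>\<bar>u y\<bar> - \<bar>u x\<bar>\<bar> = \<bar>u y - u x\<bar>"
proof -
  have lim: "(u \<longlongrightarrow> u x) (nhds x)"
    using assms by (simp add: isCont_def tendsto_at_iff_tendsto_nhds)
  consider "u x = 0" | "0 < u x" | "u x < 0" by linarith
  then show ?thesis
  proof cases
    case 2
    from order_tendstoD(1)[OF lim 2] show ?thesis by eventually_elim (use 2 in auto)
  next
    case 3
    from order_tendstoD(2)[OF lim 3] show ?thesis by eventually_elim (use 3 in auto)
  qed simp
qed

lemma norm_gradient_le_of_locally_lipschitz:
  fixes u :: "'a::euclidean_space \<Rightarrow> real"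
  assumes u: "(u has_derivative (\<lambda>h. v \<bullet> h)) (at x)" and K: "0 \<le> K"
    and lip: "\<forall>\<^sub>F y in nhds x. \<bar>u y - u x\<bar> \<le> K * norm (y - x)"
  shows "norm v \<le> K"
proof -
  have e: "norm (sgn v) \<le> 1" by (simp add: norm_sgn)
  have "((\<lambda>t. x + t *\<^sub>R sgn v) has_derivative (\<lambda>h. h *\<^sub>R sgn v)) (at 0)"
    by (auto intro!: derivative_eq_intros)
  moreover have "(u has_derivative (\<lambda>h. v \<bullet> h)) (at (x + 0 *\<^sub>R sgn v))" using u by simp
  ultimately have "((\<lambda>t. u (x + t *\<^sub>R sgn v)) has_derivative (\<lambda>h. v \<bullet> (h *\<^sub>R sgn v))) (at 0)"
    by (rule has_derivative_compose)
  moreover have "(\<lambda>h. v \<bullet> (h *\<^sub>R sgn v)) = (*) (norm v)"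
    by (auto simp: inner_sgn_self)
  ultimately have "((\<lambda>t. u (x + t *\<^sub>R sgn v)) has_real_derivative norm v) (at 0)"
    by (simp only: has_field_derivative_def)
  then have "((\<lambda>t. (u (x + t *\<^sub>R sgn v) - u x) / t) \<longlongrightarrow> norm v) (at 0)"
    by (simp add: DERIV_def)
  then show ?thesis
  proof (rule tendsto_upperbound)
    have "((\<lambda>t. x + t *\<^sub>R sgn v) \<longlongrightarrow> x + 0 *\<^sub>R sgn v) (at (0::real))"
      by (intro tendsto_intros)
    then have "filterlim (\<lambda>t. x + t *\<^sub>R sgn v) (nhds x) (at (0::real))" by simp
    from eventually_compose_filterlim[OF lip this]
    show "\<forall>\<^sub>F t in at 0. (u (x + t *\<^sub>R sgn v) - u x) / t \<le> K"
    proof eventually_elim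
      fix t :: real
      assume "\<bar>u (x + t *\<^sub>R sgn v) - u x\<bar> \<le> K * norm (x + t *\<^sub>R sgn v - x)"
      also have "\<dots> \<le> K * \<bar>t\<bar>" using e K by (intro mult_left_mono) (auto simp: mult_left_le)
      finally have "\<bar>(u (x + t *\<^sub>R sgn v) - u x) / t\<bar> \<le> K"
        using K by (cases "t = 0") (auto simp: abs_divide pos_divide_le_eq)
      then show "(u (x + t *\<^sub>R sgn v) - u x) / t \<le> K" by linarith
    qed
  qed simp
qed

section \<open>The equivalence\<close>

theorem theorem2p17:
  fixes \<psi> :: "real \<Rightarrow> real"
    and \<Omega> :: "(real ^ 'n) set"
    and u :: "real ^ 'n \<Rightarrow> real"
    and p :: real
  assumes "CARD('n) \<ge> 2"
    and "fast_majorant \<psi>"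
    and "open \<Omega>" "connected \<Omega>" "\<Omega> \<noteq> {}" "bounded \<Omega>"
    and "harmonic_on u \<Omega>"
    and "CARD('n) > 2 \<Longrightarrow> p \<ge> (real CARD('n) - 2) / (real CARD('n) - 1)"
    and "CARD('n) = 2 \<Longrightarrow> p > 0"
  defines "G1 \<equiv> u \<in> lipschitz_int \<psi> \<Omega>"
    and "G2 \<equiv> \<exists>C>0. \<forall>x\<in>\<Omega>.
           norm (gradient u x) \<le> C * (\<psi> (infdist x (frontier \<Omega>)) / infdist x (frontier \<Omega>))"
    and "G3 \<equiv> (\<lambda>x. \<bar>u x\<bar>) \<in> lipschitz_int \<psi> \<Omega>"
    and "G4 \<equiv> \<exists>C>0. \<forall>x\<in>\<Omega>.
           grad_mean \<Omega> u p x \<le> C * (\<psi> (infdist x (frontier \<Omega>)) / infdist x (frontier \<Omega>))"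
  shows "(G1 \<longleftrightarrow> G2) \<and> (G2 \<longleftrightarrow> G3) \<and> (G3 \<longleftrightarrow> G4)"
proof -
  have \<psi>: "majorant \<psi>" using assms(2) by (simp add: fast_majorant_def)
  note domain = \<open>open \<Omega>\<close> \<open>bounded \<Omega>\<close>
  note u = \<open>harmonic_on u \<Omega>\<close>
  have p: "0 < p"
  proof (cases "CARD('n) = 2")
    case False
    then have "CARD('n) > 2" using assms(1) by simp
    then have "0 < (real CARD('n) - 2) / (real CARD('n) - 1)" by simp
    then show ?thesis using assms(8)[OF \<open>CARD('n) > 2\<close>] by linarith
  qed (rule assms(9))
  let ?density = "internal_density \<psi> \<Omega>" and ?d = "\<lambda>x. infdist x (frontier \<Omega>)"
  have G2_eq: "G2 \<longleftrightarrow> (\<exists>C>0. \<forall>x\<in>\<Omega>. norm (gradient u x) \<le> C * ?density x)"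
    and G4_eq: "G4 \<longleftrightarrow> (\<exists>C>0. \<forall>x\<in>\<Omega>. grad_mean \<Omega> u p x \<le> C * ?density x)"
    by (simp_all add: G2_def G4_def internal_density_def)
  have "G1 \<Longrightarrow> G3"
  proof -
    have "\<bar>\<bar>a\<bar> - \<bar>b\<bar>\<bar> \<le> t" if "\<bar>a - b\<bar> \<le> t" for a b t :: real using that by linarith
    then show "G1 \<Longrightarrow> G3"
      unfolding G1_def G3_def lipschitz_int_def real_norm_def mem_Collect_eq by meson
  qed
  moreover have "G3 \<Longrightarrow> G2"
  proof -
    assume G3
    then obtain C where C: "0 < C" "\<And>x. x \<in> \<Omega> \<Longrightarrow>
        \<forall>\<^sub>F y in nhds x. \<bar>\<bar>u y\<bar> - \<bar>u x\<bar>\<bar> \<le> C * ?density x * norm (y - x)"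
      unfolding G3_def by (elim lipschitz_int_locally_lipschitz[OF domain \<psi>]) auto
    have "norm (gradient u x) \<le> C * ?density x" if x: "x \<in> \<Omega>" for x
    proof (rule norm_gradient_le_of_locally_lipschitz)
      show der: "(u has_derivative (\<lambda>h. gradient u x \<bullet> h)) (at x)"
        by (rule harmonic_on_has_derivative[OF u x])
      show "0 \<le> C * ?density x" using C(1) internal_density_nonneg[OF \<psi>, of \<Omega> x] by simp
      show "\<forall>\<^sub>F y in nhds x. \<bar>u y - u x\<bar> \<le> C * ?density x * norm (y - x)"
        using C(2)[OF x] abs_diff_abs_eventually_eq[OF has_derivative_continuous[OF der]]
        by eventually_elim simp
    qed
    then show G2 unfolding G2_eq using C(1) by blast
  qed
  moreover have "G2 \<Longrightarrow> G1"
  proof -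
    assume G2
    then obtain C where C: "0 < C" "\<And>x. x \<in> \<Omega> \<Longrightarrow> norm (gradient u x) \<le> C * ?density x"
      unfolding G2_eq by blast
    show G1 unfolding G1_def
    proof (rule lipschitz_intI_derivative_bound[OF domain \<open>connected \<Omega>\<close> \<psi> C(1)])
      fix x h assume x: "x \<in> \<Omega>"
      show "(u has_derivative (\<lambda>h. gradient u x \<bullet> h)) (at x)"
        by (rule harmonic_on_has_derivative[OF u x])
      have "\<bar>gradient u x \<bullet> h\<bar> \<le> norm (gradient u x) * norm h" by (rule Cauchy_Schwarz_ineq2)
      also have "\<dots> \<le> C * ?density x * norm h" using C(2)[OF x] by (intro mult_right_mono) auto
      finally show "\<bar>gradient u x \<bullet> h\<bar> \<le> C * ?density x * norm h" .
    qed
  qed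
  moreover have "G2 \<Longrightarrow> G4"
  proof -
    assume G2
    then obtain C where C: "0 < C" "\<And>x. x \<in> \<Omega> \<Longrightarrow> norm (gradient u x) \<le> C * ?density x"
      unfolding G2_eq by blast
    have "grad_mean \<Omega> u p x \<le> (2 * C) * ?density x" if x: "x \<in> \<Omega>" for x
      unfolding grad_mean_def Let_def
    proof (rule power_mean_le[OF _ _ p])
      note sub = cball_half_infdist_subset[OF domain x]
      show "continuous_on (cball x (?d x / 2)) (\<lambda>y. norm (gradient u y))"
        by (intro continuous_intros continuous_on_subset[OF harmonic_on_continuous_gradient[OF u] sub])
      show "0 < ?d x / 2" using infdist_frontier_pos[OF domain x] by simp
      fix y assume y: "y \<in> cball x (?d x / 2)"
      have "norm (gradient u y) \<le> C * ?density y" using C(2) sub y by blast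
      also have "\<dots> \<le> C * (2 * ?density x)"
        using C(1) internal_density_le_twice[OF domain \<psi> x y] by (intro mult_left_mono) auto
      finally show "0 \<le> norm (gradient u y) \<and> norm (gradient u y) \<le> 2 * C * ?density x" by simp
    qed
    then show G4 unfolding G4_eq using C(1) by (intro exI[of _ "2 * C"]) auto
  qed
  moreover have "G4 \<Longrightarrow> G2"
  proof -
    assume G4
    then obtain C where C: "0 < C" "\<And>x. x \<in> \<Omega> \<Longrightarrow> grad_mean \<Omega> u p x \<le> C * ?density x"
      unfolding G4_eq by blast
    obtain K where K: "0 < K" "\<And>x \<rho>. 0 < \<rho> \<Longrightarrow> cball x \<rho> \<subseteq> \<Omega> \<Longrightarrow>
      norm (gradient u x) \<le> K * (1 / measure lebesgue (ball x \<rho>) *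
        (LINT y:ball x \<rho>|lebesgue. norm (gradient u y) powr p)) powr (1 / p)"
      using norm_gradient_le_power_mean[OF u p] by metis
    have "norm (gradient u x) \<le> (K * C) * ?density x" if x: "x \<in> \<Omega>" for x
    proof -
      have "norm (gradient u x) \<le> K * grad_mean \<Omega> u p x"
        unfolding grad_mean_def Let_def
        by (rule K(2)) (use infdist_frontier_pos[OF domain x] cball_half_infdist_subset[OF domain x] in auto)
      also have "\<dots> \<le> K * (C * ?density x)" using K(1) C(2)[OF x] by (intro mult_left_mono) auto
      finally show ?thesis by (simp add: mult.assoc)
    qed
    then show G2 unfolding G2_eq using K(1) C(1) by (intro exI[of _ "K * C"]) auto
  qed
  ultimately show ?thesis by blast
qed

end
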